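(* Let $h:\mathbb{R}\to\mathbb{R}$ and $x^\star\in\mathbb{R}$ satisfy Assumptions (A1) and (A2) of the context, and let $r,\delta,d$ be arbitrary positive numbers such that $r-d-2\delta>0$. Let $\mathcal{A}_\delta$, $\chi$, $L_r$, $M_r$ be as in the context and let $r_0:=\chi(r-d-2\delta)$. Then there exist $\bar t=\bar t(r_0,d)$ and $\gamma^\star=\gamma^\star(M_r,L_r,\delta,d)>0$ such that for any $\gamma\in(0,\gamma^\star)$ and any $x_0\in\mathbb{R}$ with $|x_0-x^\star|\le r_0$, the trajectory of $$\dot x=-\gamma\,h\big(x+\delta u(t)\big)\,u(t),\qquad x(0)=x_0,\qquad u(t)=\sin(2\pi t),$$ is bounded and $$|x(t)|_{\mathcal{A}_\delta}\le d\qquad\forall\,t\ge\frac{\bar t}{\gamma}.$$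
   Context: Assumption (A1): $h$ is smooth and $x^\star\in\mathbb{R}$ is such that $h(x)-h(x^\star)>0$ for all $x\in\mathbb{R}$ with $x\neq x^\star$. Assumption (A2): $h$ is locally Lipschitz and strictly quasi-convex (i.e. $h(x_1)<h(x_2)$ implies $h(\lambda x_1+(1-\lambda)x_2)<h(x_2)$ for all $\lambda\in(0,1)$), and there exists a class-$\mathcal{K}_\infty$ function $\alpha$ such that $|h(x_2)-h(x_1)|\ge\alpha(|x_2-x_1|)$ for all $x_1,x_2\in\mathbb{R}$ with $(x_1-x^\star)(x_2-x^\star)\ge 0$. The average system is $\dot x_a=-\frac{\gamma}{2}b_{1,\delta}(x_a)$ with $b_{1,\delta}(x):=2\int_0^1 h(x+\delta\sin(2\pi t))\sin(2\pi t)\,dt$. For each $\delta>0$, $\mathcal{A}_\delta\subseteq[x^\star-\delta,x^\star+\delta]$ denotes a compact set that is globally asymptotically and locally exponentially stable for the average system (the paper shows that such a set exists), and $|x|_{\mathcal{A}_\delta}$ is the distance from $x$ to $\mathcal{A}_\delta$. Accordingly, $\beta$ denotes a class-$\mathcal{KL}$ function such that every trajectory of the average system satisfies $|x_a(t)|_{\mathcal{A}_\delta}\le\beta(|x_a(0)|_{\mathcal{A}_\delta},\gamma t)$ for all $t\ge0$, with $\beta(\cdot,0)$ of class $\mathcal{K}_\infty$; and $\chi(s):=\beta^{-1}(s,0)$ is the class-$\mathcal{K}_\infty$ inverse of $s\mapsto\beta(s,0)$. For $r>0$, $L_r>0$ and $M_r>0$ are constants such that $|h(x_1)-h(x_2)|\le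 L_r|x_1-x_2|$ for all $x_1,x_2\in[x^\star-r,x^\star+r]$, and $|h(x)|\le M_r$ for all $x\in[x^\star-r,x^\star+r]$. Writing a constant as $c(p_1,p_2,\dots)$ indicates the quantities on which it depends. Class $\mathcal{K}_\infty$: continuous, strictly increasing, unbounded functions $[0,\infty)\to[0,\infty)$ vanishing at $0$. Class $\mathcal{KL}$: functions $\beta(s,t)$ on $[0,\infty)^2$, continuous, strictly increasing in $s$ with $\beta(0,t)=0$, and decreasing to $0$ in $t$. *)

theory Defs
  imports "HOL-Analysis.Analysis"
begin

text \<open>Comparison functions have domain \<open>[0,\<infinity>)\<close>; their values at negative arguments are irrelevant.\<close>

definition class_Kinf :: "(real \<Rightarrow> real) \<Rightarrow> bool" where
  "class_Kinf \<alpha> \<longleftrightarrow>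
     continuous_on {0..} \<alpha> \<and> strict_mono_on {0..} \<alpha> \<and> \<alpha> 0 = 0 \<and> filterlim \<alpha> at_top at_top"

definition class_KL :: "(real \<Rightarrow> real \<Rightarrow> real) \<Rightarrow> bool" where
  "class_KL \<beta> \<longleftrightarrow>
     continuous_on ({0..} \<times> {0..}) (\<lambda>(s, t). \<beta> s t) \<and>
     (\<forall>t\<ge>0. strict_mono_on {0..} (\<lambda>s. \<beta> s t) \<and> \<beta> 0 t = 0) \<and>
     (\<forall>s\<ge>0. antimono_on {0..} (\<beta> s) \<and> (\<beta> s \<longlongrightarrow> 0) at_top)"

definition smooth :: "(real \<Rightarrow> real) \<Rightarrow> bool" where
  "smooth h \<longleftrightarrow> (\<forall>n. ((deriv ^^ n) h) differentiable_on UNIV)"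

definition locally_lipschitz :: "(real \<Rightarrow> real) \<Rightarrow> bool" where
  "locally_lipschitz h \<longleftrightarrow> (\<forall>x. \<exists>e>0. \<exists>L. L-lipschitz_on (ball x e) h)"

definition strictly_quasi_convex :: "(real \<Rightarrow> real) \<Rightarrow> bool" where
  "strictly_quasi_convex h \<longleftrightarrow>
     (\<forall>x1 x2. h x1 < h x2 \<longrightarrow> (\<forall>l\<in>{0<..<1}. h (l * x1 + (1 - l) * x2) < h x2))"

definition assumption_A1 :: "(real \<Rightarrow> real) \<Rightarrow> real \<Rightarrow> bool" where
  "assumption_A1 h xs \<longleftrightarrow> smooth h \<and> (\<forall>x. x \<noteq> xs \<longrightarrow> h x - h xs > 0)"

definition assumption_A2 :: "(real \<Rightarrow> real) \<Rightarrow> real \<Rightarrow> bool" where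
  "assumption_A2 h xs \<longleftrightarrow>
     locally_lipschitz h \<and> strictly_quasi_convex h \<and>
     (\<exists>\<alpha>. class_Kinf \<alpha> \<and>
        (\<forall>x1 x2. (x1 - xs) * (x2 - xs) \<ge> 0 \<longrightarrow> \<bar>h x2 - h x1\<bar> \<ge> \<alpha> \<bar>x2 - x1\<bar>))"

text \<open>Forward trajectories on \<open>[0,\<infinity>)\<close>, with a one-sided derivative at time \<open>0\<close>.\<close>

definition trajectory :: "(real \<Rightarrow> real \<Rightarrow> real) \<Rightarrow> (real \<Rightarrow> real) \<Rightarrow> bool" where
  "trajectory f x \<longleftrightarrow> (\<forall>t\<ge>0. (x has_real_derivative f t (x t)) (at t within {0..}))"

definition globally_asymptotically_stable :: "(real \<Rightarrow> real \<Rightarrow> real) \<Rightarrow> real set \<Rightarrow> bool" where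
  "globally_asymptotically_stable f A \<longleftrightarrow>
     (\<forall>\<epsilon>>0. \<exists>\<eta>>0. \<forall>x. trajectory f x \<longrightarrow> infdist (x 0) A < \<eta> \<longrightarrow> (\<forall>t\<ge>0. infdist (x t) A < \<epsilon>)) \<and>
     (\<forall>x. trajectory f x \<longrightarrow> ((\<lambda>t. infdist (x t) A) \<longlongrightarrow> 0) at_top)"

definition locally_exponentially_stable :: "(real \<Rightarrow> real \<Rightarrow> real) \<Rightarrow> real set \<Rightarrow> bool" where
  "locally_exponentially_stable f A \<longleftrightarrow>
     (\<exists>\<rho>>0. \<exists>k>0. \<exists>\<mu>>0. \<forall>x. trajectory f x \<longrightarrow> infdist (x 0) A < \<rho> \<longrightarrow>
        (\<forall>t\<ge>0. infdist (x t) A \<le> k * exp (- \<mu> * t) * infdist (x 0) A))"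

definition dither :: "real \<Rightarrow> real" where
  "dither t = sin (2 * pi * t)"

definition b1 :: "(real \<Rightarrow> real) \<Rightarrow> real \<Rightarrow> real \<Rightarrow> real" where
  "b1 h \<delta> x = 2 * integral {0..1} (\<lambda>t. h (x + \<delta> * sin (2 * pi * t)) * sin (2 * pi * t))"

definition average_field :: "(real \<Rightarrow> real) \<Rightarrow> real \<Rightarrow> real \<Rightarrow> real \<Rightarrow> real \<Rightarrow> real" where
  "average_field h \<delta> \<gamma> t x = - (\<gamma> / 2) * b1 h \<delta> x"

definition es_field :: "(real \<Rightarrow> real) \<Rightarrow> real \<Rightarrow> real \<Rightarrow> real \<Rightarrow> real \<Rightarrow> real" where
  "es_field h \<delta> \<gamma> t x = - \<gamma> * h (x + \<delta> * dither t) * dither t"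

text \<open>Stability is required for every gain \<open>\<gamma> > 0\<close>, with the same set \<open>A\<close>: changing \<open>\<gamma>\<close> only
  rescales time in the average system. The set is taken nonempty because \<open>infdist x {} = 0\<close>.\<close>

definition attractor :: "(real \<Rightarrow> real) \<Rightarrow> real \<Rightarrow> real \<Rightarrow> real set \<Rightarrow> bool" where
  "attractor h xs \<delta> A \<longleftrightarrow>
     A \<noteq> {} \<and> compact A \<and> A \<subseteq> {xs - \<delta>..xs + \<delta>} \<and>
     (\<forall>\<gamma>>0. globally_asymptotically_stable (average_field h \<delta> \<gamma>) A \<and>
            locally_exponentially_stable (average_field h \<delta> \<gamma>) A)"

definition KL_estimate ::
    "(real \<Rightarrow> real) \<Rightarrow> real \<Rightarrow> real set \<Rightarrow> (real \<Rightarrow> real \<Rightarrow> real) \<Rightarrow> bool" where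
  "KL_estimate h \<delta> A \<beta> \<longleftrightarrow>
     class_KL \<beta> \<and> class_Kinf (\<lambda>s. \<beta> s 0) \<and>
     (\<forall>\<gamma>>0. \<forall>xa. trajectory (average_field h \<delta> \<gamma>) xa \<longrightarrow>
        (\<forall>t\<ge>0. infdist (xa t) A \<le> \<beta> (infdist (xa 0) A) (\<gamma> * t)))"

definition chi :: "(real \<Rightarrow> real \<Rightarrow> real) \<Rightarrow> real \<Rightarrow> real" where
  "chi \<beta> = the_inv_into {0..} (\<lambda>s. \<beta> s 0)"

definition local_bounds :: "(real \<Rightarrow> real) \<Rightarrow> real \<Rightarrow> real \<Rightarrow> real \<Rightarrow> real \<Rightarrow> bool" where
  "local_bounds h xs r L M \<longleftrightarrow>
     L > 0 \<and> M > 0 \<and>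
     (\<forall>x1\<in>{xs - r..xs + r}. \<forall>x2\<in>{xs - r..xs + r}. \<bar>h x1 - h x2\<bar> \<le> L * \<bar>x1 - x2\<bar>) \<and>
     (\<forall>x\<in>{xs - r..xs + r}. \<bar>h x\<bar> \<le> M)"

end

theory Submission
  imports Defs
begin

text \<open>Over one period of the dither the state moves by \<open>- (\<gamma>/2) b1 h \<delta> x\<close>, which is one unit of time of
the average system, up to an error of order \<open>\<gamma>\<^sup>2\<close> (\<open>es_period_map\<close>). So the sampled states
\<open>x 0, x 1, x 2, \<dots>\<close> perform a perturbed explicit Euler scheme for the average system, and on the
line such a scheme is controlled by the sign of the drift alone.

The sign comes from the attractor. Equilibria of the average system lie in \<open>A\<close>. If \<open>A\<close> had a gap, the
drift would have constant sign there, so trajectories starting in the gap near one of its end points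
would move away from it across the gap, against stability; hence \<open>A = {a..b}\<close> (\<open>attractor_is_interval\<close>).
At distance \<open>\<delta>\<close> or more to the right of \<open>xs\<close> the drift \<open>b1\<close> is nonnegative, because \<open>h\<close> is
increasing to the right of \<open>xs\<close>, and it has no zeros outside \<open>A\<close>, so it is
positive on all of \<open>{b<..}\<close>; symmetrically it is negative on \<open>{..<a}\<close> (\<open>attractor_interval_signs\<close>).

Fix a distance \<open>d\<close> and a radius \<open>\<rho>\<close> for the initial states, and let \<open>c > 0\<close> be the minimum of
\<open>\<bar>b1\<bar> / 2\<close> over the states at distance at least \<open>d/2\<close> from \<open>A\<close> in \<open>{xs - (\<rho> + \<delta> + d)..xs + (\<rho> + \<delta> + d)}\<close>. For small \<open>\<gamma>\<close>
each period moves the state by at most \<open>d/8\<close> and, at distance at least \<open>d/2\<close> from \<open>A\<close>, towards \<open>A\<close>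
by at least \<open>\<gamma> c / 2\<close>. After a number of periods proportional to \<open>1 / (\<gamma> c)\<close> the samples are within
\<open>5d/8\<close> of \<open>A\<close> and stay there, and between samples the state moves by at most another \<open>d/8\<close>
(\<open>es_practical_convergence\<close>).

The gain bound has to depend on \<open>M\<close> but not on \<open>r\<close>. This is possible because \<open>h\<close> grows at least like
the class-\<open>\<K>\<^sub>\<infinity>\<close> function \<open>\<alpha>\<close> of the second assumption: a bound \<open>M\<close> on \<open>{xs - r..xs + r}\<close> bounds \<open>r\<close>,
and with it the initial radius \<open>r0\<close> (\<open>initial_radius_bounded\<close>), so the gain can be chosen for the
largest possible radius. The settling time uses the constant \<open>c\<close> of the actual radius \<open>r0\<close>, which is
at least the one of the largest radius.\<close>

section \<open>Solutions of scalar differential equations\<close>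

text \<open>Trajectories restricted to a set of times. Bounded intervals are needed because estimates are first
proved up to the time at which a trajectory might leave the region where \<open>h\<close> is controlled.\<close>

definition solution_on :: "(real \<Rightarrow> real \<Rightarrow> real) \<Rightarrow> real set \<Rightarrow> (real \<Rightarrow> real) \<Rightarrow> bool" where
  "solution_on f S x \<longleftrightarrow> (\<forall>t\<in>S. (x has_real_derivative f t (x t)) (at t within S))"

lemma trajectory_iff_solution_on: "trajectory f x \<longleftrightarrow> solution_on f {0..} x"
  by (auto simp: trajectory_def solution_on_def)

lemma solution_on_subset: "solution_on f S x \<Longrightarrow> T \<subseteq> S \<Longrightarrow> solution_on f T x"
  unfolding solution_on_def by (meson DERIV_subset subsetD)

lemma solution_on_cong:
  assumes "solution_on f S x" "\<And>t. t \<in> S \<Longrightarrow> f t (x t) = g t (x t)"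
  shows "solution_on g S x"
  using assms unfolding solution_on_def by metis

lemma solution_on_continuous: "solution_on f S x \<Longrightarrow> continuous_on S x"
  unfolding solution_on_def by (rule DERIV_continuous_on) auto

lemma solution_on_mvt:
  assumes "solution_on f {a..b} x" "a < b"
  obtains \<xi> where "a < \<xi>" "\<xi> < b" "x b - x a = (b - a) * f \<xi> (x \<xi>)"
proof -
  have "\<exists>\<xi>\<in>{a<..<b}. x b - x a = (\<lambda>h. h * f \<xi> (x \<xi>)) (b - a)"
    using assms
    by (intro mvt_simple) (auto simp: solution_on_def has_field_derivative_def mult_commute_abs)
  then show thesis using that by auto
qed

lemma solution_on_uminus:
  assumes "solution_on f S x"
  shows "solution_on (\<lambda>t y. - f t (- y)) S (\<lambda>t. - x t)"
  using assms unfolding solution_on_def by (auto intro!: DERIV_minus)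

text \<open>Picard iteration on the whole half line at once: \<open>x t = x0 + exp (2 K t) y t\<close> turns the integral
equation into a fixed point equation for a bounded function \<open>y\<close>, and the exponential weight makes
the right-hand side a contraction with factor \<open>1/2\<close> in the supremum norm. Boundedness of \<open>f\<close> is what
keeps the weighted integral bounded.\<close>

lemma trajectory_exists:
  fixes f :: "real \<Rightarrow> real \<Rightarrow> real"
  assumes cont: "continuous_on UNIV (\<lambda>(t, x). f t x)"
    and bound: "\<And>t x. \<bar>f t x\<bar> \<le> B"
    and lip: "\<And>t x y. \<bar>f t x - f t y\<bar> \<le> L * \<bar>x - y\<bar>"
  shows "\<exists>x. trajectory f x \<and> x 0 = x0"
proof -
  define K where "K = \<bar>L\<bar> + 1"
  have K: "K > 0" by (simp add: K_def)
  have lipK: "\<bar>f t x - f t y\<bar> \<le> K * \<bar>x - y\<bar>" for t x y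
    by (rule order_trans[OF lip mult_right_mono]) (auto simp: K_def)
  have B: "B \<ge> 0" using bound[of 0 0] by linarith
  define F where "F y \<tau> = f \<tau> (x0 + exp (2 * K * \<tau>) * y \<tau>)" for y :: "real \<Rightarrow> real" and \<tau>
  define G where "G y s = integral {0..s} (F y)" for y s
  \<comment> \<open>The maximum extends the iterates by a constant to negative times, as the space of bounded
    continuous functions is taken over the whole line.\<close>
  define \<Phi> where "\<Phi> y t = exp (- 2 * K * max 0 t) * G y (max 0 t)" for y :: "real \<Rightarrow> real" and t
  have contF: "continuous_on S (F y)" if "continuous_on UNIV y" for y S
  proof -
    have "continuous_on S (\<lambda>\<tau>. (\<lambda>(t, x). f t x) (\<tau>, x0 + exp (2 * K * \<tau>) * y \<tau>))"
      by (rule continuous_on_compose2[OF cont])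
        (auto intro!: continuous_intros continuous_on_subset[OF that])
    then show ?thesis by (simp add: F_def[abs_def])
  qed
  have intF: "F y integrable_on {0..s}" if "continuous_on UNIV y" for y s
    using contF[OF that] by (rule integrable_continuous_real)
  have derivG: "(G y has_real_derivative F y s) (at s within {0..})"
    if "continuous_on UNIV y" "s \<ge> 0" for y s
  proof -
    have "((\<lambda>u. integral {0..u} (F y)) has_real_derivative F y s) (at s within {0..s + 1})"
      using that by (intro integral_has_real_derivative contF) auto
    moreover have "at s within {0..s + 1} = at s within {0..}"
      by (rule at_within_nhd[of _ "{..<s + 1}"]) (auto simp: that)
    ultimately show ?thesis by (simp add: G_def[abs_def])
  qed
  have contG: "continuous_on {0..} (G y)" if "continuous_on UNIV y" for y
    by (rule DERIV_continuous_on) (use derivG[OF that] in auto)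
  have cont\<Phi>: "continuous_on UNIV (\<Phi> y)" if "continuous_on UNIV y" for y
    unfolding \<Phi>_def
    by (intro continuous_intros continuous_on_compose2[OF contG[OF that]]) auto
  have bound\<Phi>: "\<bar>\<Phi> y t\<bar> \<le> B / (2 * K)" if "continuous_on UNIV y" for y t
  proof -
    define s where "s = max 0 t"
    have s: "s \<ge> 0" by (simp add: s_def)
    have "norm (G y s) \<le> integral {0..s} (\<lambda>_. B)"
      unfolding G_def by (intro integral_norm_bound_integral intF[OF that]) (auto simp: F_def bound)
    then have 1: "\<bar>G y s\<bar> \<le> B * s" using s by (simp add: mult.commute)
    have "s \<le> exp (2 * K * s) / (2 * K)"
    proof -
      have "2 * K * s \<le> exp (2 * K * s)" using exp_ge_add_one_self[of "2 * K * s"] by linarith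
      then show ?thesis using K by (simp add: field_simps)
    qed
    then have "B * s \<le> B * (exp (2 * K * s) / (2 * K))" using B by (rule mult_left_mono)
    then have "\<bar>G y s\<bar> \<le> B / (2 * K) * exp (2 * K * s)" using 1 by simp
    then have "exp (- 2 * K * s) * \<bar>G y s\<bar> \<le> exp (- 2 * K * s) * (B / (2 * K) * exp (2 * K * s))"
      by (intro mult_left_mono) auto
    also have "\<dots> = B / (2 * K)" by (simp add: exp_minus)
    finally show ?thesis by (simp add: \<Phi>_def s_def[symmetric] abs_mult)
  qed
  define P where "P y = Bcontfun (\<Phi> (apply_bcontfun y))" for y :: "real \<Rightarrow>\<^sub>C real"
  have apply_P: "apply_bcontfun (P y) = \<Phi> (apply_bcontfun y)" for y
    unfolding P_def by (rule Bcontfun_inverse, rule bcontfun_normI[OF cont\<Phi>])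
      (auto intro: bound\<Phi>)
  have contraction: "dist (P y) (P z) \<le> 1/2 * dist y z" for y z
  proof (rule dist_bound)
    fix t :: real
    define s where "s = max 0 t"
    define D where "D = dist y z"
    have s: "s \<ge> 0" by (simp add: s_def)
    have "((\<lambda>\<tau>. K * exp (2 * K * \<tau>) * D) has_integral
        exp (2 * K * s) * D / 2 - exp (2 * K * 0) * D / 2) {0..s}"
      using s by (intro fundamental_theorem_of_calculus)
        (auto intro!: derivative_eq_intros simp: has_real_derivative_iff_has_vector_derivative[symmetric])
    then have I: "((\<lambda>\<tau>. K * exp (2 * K * \<tau>) * D) has_integral (exp (2 * K * s) - 1) * D / 2) {0..s}"
      by (simp add: field_simps)
    have "norm (integral {0..s} (\<lambda>\<tau>. F y \<tau> - F z \<tau>)) \<le> integral {0..s} (\<lambda>\<tau>. K * exp (2 * K * \<tau>) * D)"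
    proof (rule integral_norm_bound_integral)
      show "(\<lambda>\<tau>. F y \<tau> - F z \<tau>) integrable_on {0..s}"
        by (intro integrable_diff intF) auto
      show "(\<lambda>\<tau>. K * exp (2 * K * \<tau>) * D) integrable_on {0..s}" using I by blast
      fix \<tau> :: real
      have "norm (F y \<tau> - F z \<tau>) \<le> K * (exp (2 * K * \<tau>) * \<bar>y \<tau> - z \<tau>\<bar>)"
        using lipK[of \<tau> "x0 + exp (2 * K * \<tau>) * y \<tau>" "x0 + exp (2 * K * \<tau>) * z \<tau>"]
        by (simp add: F_def abs_mult right_diff_distrib[symmetric])
      also have "\<dots> \<le> K * (exp (2 * K * \<tau>) * D)"
        using K dist_bounded[of y \<tau> z] by (intro mult_left_mono) (auto simp: D_def dist_real_def)
      finally show "norm (F y \<tau> - F z \<tau>) \<le> K * exp (2 * K * \<tau>) * D" by (simp add: mult.assoc)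
    qed
    also have "\<dots> = (exp (2 * K * s) - 1) * D / 2" using I by (rule integral_unique)
    also have "\<dots> \<le> exp (2 * K * s) * (D / 2)" by (simp add: algebra_simps D_def)
    also have "integral {0..s} (\<lambda>\<tau>. F y \<tau> - F z \<tau>) = G y s - G z s"
      unfolding G_def by (intro integral_diff intF) auto
    finally have "exp (- 2 * K * s) * \<bar>G y s - G z s\<bar> \<le> exp (- 2 * K * s) * (exp (2 * K * s) * (D / 2))"
      by (intro mult_left_mono) auto
    then show "dist (apply_bcontfun (P y) t) (apply_bcontfun (P z) t) \<le> 1/2 * dist y z"
      by (simp add: apply_P \<Phi>_def s_def[symmetric] dist_real_def right_diff_distrib[symmetric]
          abs_mult D_def exp_minus field_simps)
  qed
  obtain y where y: "P y = y"
    using banach_fix_type[of "1/2" P] contraction by auto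
  define x where "x t = x0 + G y t" for t
  have fp: "exp (2 * K * t) * y t = G y t" if "t \<ge> 0" for t
  proof -
    have "y t = exp (- 2 * K * t) * G y t"
      using apply_P[of y] that by (simp add: y \<Phi>_def fun_eq_iff)
    then show ?thesis by (simp add: exp_minus)
  qed
  have "trajectory f x"
    unfolding trajectory_def
  proof (intro allI impI)
    fix t :: real assume t: "t \<ge> 0"
    have "F y t = f t (x t)" using fp[OF t] by (simp add: F_def x_def)
    moreover have "(x has_real_derivative 0 + F y t) (at t within {0..})"
      unfolding x_def by (intro DERIV_add DERIV_const derivG t) auto
    ultimately show "(x has_real_derivative f t (x t)) (at t within {0..})" by simp
  qed
  moreover have "x 0 = x0" by (simp add: x_def G_def)
  ultimately show ?thesis by blast
qed

text \<open>Used for continuation arguments: an estimate valid before the hitting time contradicts hitting.\<close>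

lemma first_hitting_time:
  fixes y :: "real \<Rightarrow> real"
  assumes "continuous_on {0..t} y" "y 0 < c" "c \<le> y t" "0 \<le> t"
  obtains s where "0 < s" "s \<le> t" "y s = c" "\<And>u. 0 \<le> u \<Longrightarrow> u < s \<Longrightarrow> y u < c"
proof -
  have "closed {u\<in>{0..t}. c \<le> y u}"
    by (intro continuous_on_closed_Collect_le assms continuous_intros)
  moreover have "bounded {u\<in>{0..t}. c \<le> y u}"
    by (rule bounded_subset[OF bounded_closed_interval[of 0 t]]) auto
  ultimately have cpt: "compact {u\<in>{0..t}. c \<le> y u}" by (simp add: compact_eq_bounded_closed)
  have ne: "{u\<in>{0..t}. c \<le> y u} \<noteq> {}" using assms by auto
  obtain s where s: "s \<in> {u\<in>{0..t}. c \<le> y u}" "\<forall>u\<in>{u\<in>{0..t}. c \<le> y u}. s \<le> u"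
    by (rule bexE[OF compact_attains_inf[OF cpt ne]])
  have below: "y u < c" if "0 \<le> u" "u < s" for u
  proof (rule ccontr)
    assume "\<not> y u < c"
    then have "s \<le> u" using s that by auto
    then show False using that by simp
  qed
  obtain u where u: "0 \<le> u" "u \<le> s" "y u = c"
    using IVT'[of y 0 c s] s assms continuous_on_subset[OF assms(1), of "{0..s}"] by auto
  then have "u = s" using below[of u] by force
  moreover have "s \<noteq> 0" using s(1) assms(2) by auto
  then have "s > 0" using s(1) by auto
  ultimately show thesis using that[of s] below u s by auto
qed

text \<open>If the solution were above \<open>c\<close> at some time, it would be above \<open>c\<close> ever since its last visit to \<open>{..c}\<close>,
hence nonincreasing there by the mean value theorem.\<close>

lemma solution_stays_below:
  assumes sol: "solution_on f {0..} x" and "x 0 \<le> c" and "t \<ge> 0"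
    and inward: "\<And>t y. c < y \<Longrightarrow> f t y \<le> 0"
  shows "x t \<le> c"
proof (rule ccontr)
  assume "\<not> x t \<le> c"
  have cont: "continuous_on {0..t} x"
    by (rule solution_on_continuous[OF solution_on_subset[OF sol]]) auto
  have "closed {u\<in>{0..t}. x u \<le> c}"
    by (intro continuous_on_closed_Collect_le cont continuous_intros)
  moreover have "bounded {u\<in>{0..t}. x u \<le> c}"
    by (rule bounded_subset[OF bounded_closed_interval[of 0 t]]) auto
  ultimately have cpt: "compact {u\<in>{0..t}. x u \<le> c}" by (simp add: compact_eq_bounded_closed)
  have ne: "{u\<in>{0..t}. x u \<le> c} \<noteq> {}" using assms(2,3) by auto
  obtain s where s: "s \<in> {u\<in>{0..t}. x u \<le> c}" "\<forall>u\<in>{u\<in>{0..t}. x u \<le> c}. u \<le> s"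
    by (rule bexE[OF compact_attains_sup[OF cpt ne]])
  have "s \<noteq> t" using s(1) \<open>\<not> x t \<le> c\<close> by auto
  then have "s < t" using s(1) by auto
  have "solution_on f {s..t} x" by (rule solution_on_subset[OF sol]) (use s in auto)
  then obtain \<xi> where \<xi>: "s < \<xi>" "\<xi> < t" "x t - x s = (t - s) * f \<xi> (x \<xi>)"
    using \<open>s < t\<close> by (rule solution_on_mvt)
  have "\<not> x \<xi> \<le> c"
  proof
    assume "x \<xi> \<le> c"
    then have "\<xi> \<le> s" using s \<xi>(1,2) by auto
    then show False using \<xi>(1) by simp
  qed
  then have "c < x \<xi>" by simp
  then have "(t - s) * f \<xi> (x \<xi>) \<le> 0" using inward[of "x \<xi>" \<xi>] \<open>s < t\<close> by (simp add: mult_nonneg_nonpos)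
  then show False using \<xi> s \<open>\<not> x t \<le> c\<close> by auto
qed

section \<open>Saturating a function outside an interval\<close>

text \<open>The function \<open>h\<close> after projecting its argument to \<open>{xs - R..xs + R}\<close>. Local bounds and Lipschitz
constants of \<open>h\<close> become global ones, so that solutions exist for all time; where they stay in the
interval, they solve the original equation.\<close>

definition saturate :: "real \<Rightarrow> real \<Rightarrow> (real \<Rightarrow> real) \<Rightarrow> real \<Rightarrow> real" where
  "saturate xs R h x = h (max (xs - R) (min (xs + R) x))"

lemma saturate_eq: "\<bar>x - xs\<bar> \<le> R \<Longrightarrow> saturate xs R h x = h x"
  unfolding saturate_def by (rule arg_cong[of _ _ h]) auto

lemma saturate_bounded:
  assumes "0 \<le> R" "\<And>x. \<bar>x - xs\<bar> \<le> R \<Longrightarrow> \<bar>h x\<bar> \<le> M"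
  shows "\<bar>saturate xs R h x\<bar> \<le> M"
  unfolding saturate_def using assms by auto

lemma saturate_lipschitz:
  assumes "0 \<le> R" "0 \<le> L"
    and "\<And>x y. \<bar>x - xs\<bar> \<le> R \<Longrightarrow> \<bar>y - xs\<bar> \<le> R \<Longrightarrow> \<bar>h x - h y\<bar> \<le> L * \<bar>x - y\<bar>"
  shows "\<bar>saturate xs R h x - saturate xs R h y\<bar> \<le> L * \<bar>x - y\<bar>"
proof -
  define u v where "u = max (xs - R) (min (xs + R) x)" and "v = max (xs - R) (min (xs + R) y)"
  have "\<bar>u - xs\<bar> \<le> R" "\<bar>v - xs\<bar> \<le> R" "\<bar>u - v\<bar> \<le> \<bar>x - y\<bar>"
    using assms(1) by (auto simp: u_def v_def)
  then have "\<bar>h u - h v\<bar> \<le> L * \<bar>u - v\<bar>" "L * \<bar>u - v\<bar> \<le> L * \<bar>x - y\<bar>"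
    using assms(2,3) by (auto intro: mult_left_mono)
  then show ?thesis by (simp add: saturate_def u_def v_def)
qed

lemma lipschitz_imp_continuous:
  fixes g :: "real \<Rightarrow> real"
  assumes "0 \<le> L" "\<And>x y. \<bar>g x - g y\<bar> \<le> L * \<bar>x - y\<bar>"
  shows "continuous_on UNIV g"
  by (rule lipschitz_on_continuous_on[of L]) (auto simp: lipschitz_on_def dist_real_def assms)

lemma smooth_imp_continuous: "smooth h \<Longrightarrow> continuous_on UNIV h"
  unfolding smooth_def by (drule spec[of _ 0]) (simp add: differentiable_imp_continuous_on)

lemma smooth_lipschitz_bounded_on_interval:
  assumes "smooth h"
  obtains M L where "0 < M" "0 < L" "\<And>x. \<bar>x - c\<bar> \<le> R \<Longrightarrow> \<bar>h x\<bar> \<le> M"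
    "\<And>x y. \<bar>x - c\<bar> \<le> R \<Longrightarrow> \<bar>y - c\<bar> \<le> R \<Longrightarrow> \<bar>h x - h y\<bar> \<le> L * \<bar>x - y\<bar>"
proof -
  have "((deriv ^^ 0) h) differentiable_on UNIV" "((deriv ^^ 1) h) differentiable_on UNIV"
    using assms unfolding smooth_def by blast+
  then have diff: "h differentiable_on UNIV" "deriv h differentiable_on UNIV" by auto
  let ?I = "{c - R..c + R}"
  have I: "x \<in> ?I \<longleftrightarrow> \<bar>x - c\<bar> \<le> R" for x by auto
  have "compact (h ` ?I)" "compact (deriv h ` ?I)"
    using diff[THEN differentiable_imp_continuous_on] by (auto intro!: compact_continuous_image intro: continuous_on_subset)
  then obtain M L where bds: "0 < M" "0 < L" "\<forall>y\<in>h ` ?I. norm y \<le> M" "\<forall>y\<in>deriv h ` ?I. norm y \<le> L"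
    by (meson compact_imp_bounded bounded_pos)
  have "\<bar>h x - h y\<bar> \<le> L * \<bar>x - y\<bar>" if "\<bar>x - c\<bar> \<le> R" "\<bar>y - c\<bar> \<le> R" for x y
  proof -
    have "(h has_field_derivative deriv h z) (at z within ?I)" for z
      using diff(1) by (metis DERIV_deriv_iff_real_differentiable UNIV_I differentiable_on_def has_field_derivative_at_within)
    from field_differentiable_bound[OF _ this, of L x y] show ?thesis
      using bds(4) that I by auto
  qed
  moreover have "\<bar>h x\<bar> \<le> M" if "\<bar>x - c\<bar> \<le> R" for x using bds(3) that by (auto simp: I[symmetric])
  ultimately show thesis using that bds(1,2) by blast
qed

section \<open>The averaged drift\<close>

lemma b1_integrable:
  assumes "continuous_on UNIV g"
  shows "(\<lambda>t. g (x + \<delta> * sin (2 * pi * t)) * sin (2 * pi * t)) integrable_on {0..1}"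
  by (intro integrable_continuous_real continuous_intros continuous_on_compose2[OF assms]) auto

lemma sin_2pi_has_integral_0: "((\<lambda>t. sin (2 * pi * t)) has_integral 0) {0..1::real}"
proof -
  have "((\<lambda>t. sin (2 * pi * t)) has_integral
      (- cos (2 * pi * 1) / (2 * pi)) - (- cos (2 * pi * 0) / (2 * pi))) {0..1}"
    by (intro fundamental_theorem_of_calculus)
      (auto intro!: derivative_eq_intros simp: has_real_derivative_iff_has_vector_derivative[symmetric])
  then show ?thesis by simp
qed

lemma b1_cong:
  assumes "\<And>y. \<bar>y - x\<bar> \<le> \<bar>\<delta>\<bar> \<Longrightarrow> g y = h y"
  shows "b1 g \<delta> x = b1 h \<delta> x"
proof -
  have "g (x + \<delta> * sin s) = h (x + \<delta> * sin s)" for s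
    using assms mult_left_mono[of "\<bar>sin s\<bar>" 1 "\<bar>\<delta>\<bar>"] by (simp add: abs_mult)
  then show ?thesis by (simp add: b1_def)
qed

lemma b1_lipschitz:
  assumes cont: "continuous_on UNIV g"
    and lip: "\<And>u v. \<bar>u - x\<bar> \<le> \<bar>\<delta>\<bar> \<Longrightarrow> \<bar>v - y\<bar> \<le> \<bar>\<delta>\<bar> \<Longrightarrow> \<bar>g u - g v\<bar> \<le> L * \<bar>u - v\<bar>"
  shows "\<bar>b1 g \<delta> x - b1 g \<delta> y\<bar> \<le> 2 * L * \<bar>x - y\<bar>"
proof -
  let ?w = "\<lambda>x t. g (x + \<delta> * sin (2 * pi * t)) * sin (2 * pi * t)"
  have bd: "\<bar>?w x t - ?w y t\<bar> \<le> L * \<bar>x - y\<bar>" for t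
  proof -
    have "\<bar>\<delta> * sin (2 * pi * t)\<bar> \<le> \<bar>\<delta>\<bar>"
      using mult_left_mono[of "\<bar>sin (2 * pi * t)\<bar>" 1 "\<bar>\<delta>\<bar>"] by (simp add: abs_mult)
    then have "\<bar>g (x + \<delta> * sin (2 * pi * t)) - g (y + \<delta> * sin (2 * pi * t))\<bar> \<le> L * \<bar>x - y\<bar>"
      using lip[of "x + \<delta> * sin (2 * pi * t)" "y + \<delta> * sin (2 * pi * t)"] by simp
    then have "\<bar>g (x + \<delta> * sin (2 * pi * t)) - g (y + \<delta> * sin (2 * pi * t))\<bar> * \<bar>sin (2 * pi * t)\<bar>
        \<le> (L * \<bar>x - y\<bar>) * 1"
      by (intro mult_mono) auto
    then show ?thesis by (simp add: abs_mult[symmetric] left_diff_distrib)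
  qed
  have "norm (integral {0..1} (\<lambda>t. ?w x t - ?w y t)) \<le> integral {0..1} (\<lambda>t::real. L * \<bar>x - y\<bar>)"
    using bd by (intro integral_norm_bound_integral integrable_diff b1_integrable[OF cont]) auto
  also have "integral {0..1} (\<lambda>t. ?w x t - ?w y t) = integral {0..1} (?w x) - integral {0..1} (?w y)"
    by (intro integral_diff b1_integrable[OF cont])
  finally show ?thesis by (simp add: b1_def)
qed

lemma b1_continuous:
  assumes "smooth h"
  shows "continuous_on UNIV (b1 h \<delta>)"
proof -
  have cont: "continuous_on UNIV h" using assms by (rule smooth_imp_continuous)
  have "isCont (b1 h \<delta>) x" for x
  proof -
    obtain M L where L: "0 < L" "\<And>y z. \<bar>y - x\<bar> \<le> 1 + \<bar>\<delta>\<bar> \<Longrightarrow> \<bar>z - x\<bar> \<le> 1 + \<bar>\<delta>\<bar> \<Longrightarrow> \<bar>h y - h z\<bar> \<le> L * \<bar>y - z\<bar>"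
      by (rule smooth_lipschitz_bounded_on_interval[OF assms, of x "1 + \<bar>\<delta>\<bar>"]) blast
    have "(2 * L)-lipschitz_on (ball x 1) (b1 h \<delta>)"
    proof (rule lipschitz_onI)
      fix y z assume "y \<in> ball x 1" "z \<in> ball x 1"
      then have "\<bar>y - x\<bar> < 1" "\<bar>z - x\<bar> < 1" by (auto simp: dist_real_def)
      then show "dist (b1 h \<delta> y) (b1 h \<delta> z) \<le> 2 * L * dist y z"
        unfolding dist_real_def by (intro b1_lipschitz[OF cont] L(2)) linarith+
    qed (use L in simp)
    then show ?thesis
      using lipschitz_on_continuous_on continuous_on_eq_continuous_at[OF open_ball, of x 1] by fastforce
  qed
  then show ?thesis by (simp add: continuous_at_imp_continuous_on)
qed

text \<open>Subtracting the constant \<open>g x\<close> from \<open>g\<close> does not change the integral, since the sine has mean zero.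
Afterwards the integrand is pointwise nonnegative: \<open>g (x + \<delta> s) - g x\<close> has the sign of \<open>s\<close>.\<close>

lemma b1_nonneg_right:
  assumes cont: "continuous_on UNIV g" and mono: "mono_on {xs..} g" and "0 \<le> \<delta>" "xs + \<delta> \<le> x"
  shows "0 \<le> b1 g \<delta> x"
proof -
  let ?w = "\<lambda>t. g (x + \<delta> * sin (2 * pi * t)) * sin (2 * pi * t)"
  let ?v = "\<lambda>t. g x * sin (2 * pi * t)"
  have "?v t \<le> ?w t" for t
  proof -
    let ?s = "sin (2 * pi * t)"
    have "-\<delta> \<le> \<delta> * ?s"
      using mult_left_mono[of "-1" ?s \<delta>] assms(3) by simp
    then have dom: "x + \<delta> * ?s \<in> {xs..}" "x \<in> {xs..}" using assms(3,4) by auto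
    show ?thesis
    proof (cases "0 \<le> ?s")
      case True
      then have "g x \<le> g (x + \<delta> * ?s)"
        using assms(3) by (intro mono_onD[OF mono] dom) auto
      then show ?thesis using True by (rule mult_right_mono)
    next
      case False
      then have "g (x + \<delta> * ?s) \<le> g x"
        using assms(3) by (intro mono_onD[OF mono] dom) (auto simp: mult_nonneg_nonpos)
      then show ?thesis using False by (intro mult_right_mono_neg) auto
    qed
  qed
  moreover have "(?v has_integral g x * 0) {0..1}"
    by (intro has_integral_mult_right sin_2pi_has_integral_0)
  ultimately have "g x * 0 \<le> integral {0..1} ?w"
    by (intro has_integral_le[OF _ integrable_integral[OF b1_integrable[OF cont]]]) auto
  then show ?thesis by (simp add: b1_def)
qed

lemma b1_nonpos_left:
  assumes cont: "continuous_on UNIV g" and mono: "antimono_on {..xs} g" and "0 \<le> \<delta>" "x \<le> xs - \<delta>"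
  shows "b1 g \<delta> x \<le> 0"
proof -
  let ?w = "\<lambda>t. g (x + \<delta> * sin (2 * pi * t)) * sin (2 * pi * t)"
  let ?v = "\<lambda>t. g x * sin (2 * pi * t)"
  have "?w t \<le> ?v t" for t
  proof -
    let ?s = "sin (2 * pi * t)"
    have "\<delta> * ?s \<le> \<delta>"
      using mult_left_mono[of ?s 1 \<delta>] assms(3) by simp
    then have dom: "x + \<delta> * ?s \<in> {..xs}" "x \<in> {..xs}" using assms(3,4) by auto
    show ?thesis
    proof (cases "0 \<le> ?s")
      case True
      then have "g (x + \<delta> * ?s) \<le> g x"
        using assms(3) by (intro monotone_onD[OF mono] dom) auto
      then show ?thesis using True by (rule mult_right_mono)
    next
      case False
      then have "g x \<le> g (x + \<delta> * ?s)"
        using assms(3) by (intro monotone_onD[OF mono] dom) (auto simp: mult_nonneg_nonpos)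
      then show ?thesis using False by (intro mult_right_mono_neg) auto
    qed
  qed
  moreover have "(?v has_integral g x * 0) {0..1}"
    by (intro has_integral_mult_right sin_2pi_has_integral_0)
  ultimately have "integral {0..1} ?w \<le> g x * 0"
    by (intro has_integral_le[OF integrable_integral[OF b1_integrable[OF cont]]]) auto
  then show ?thesis by (simp add: b1_def)
qed

text \<open>A point strictly between \<open>xs\<close> and \<open>y\<close> is a proper convex combination of \<open>y\<close> and the strict
minimizer \<open>xs\<close>, so quasi-convexity puts its value below \<open>h y\<close>.\<close>

lemma quasi_convex_monotone:
  assumes "assumption_A1 h xs" "assumption_A2 h xs"
  shows "mono_on {xs..} h" and "antimono_on {..xs} h"
proof -
  have min: "h xs < h y" if "y \<noteq> xs" for y
    using assms(1) that by (force simp: assumption_A1_def)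
  have between: "h (l * xs + (1 - l) * y) < h y" if "y \<noteq> xs" "0 < l" "l < 1" for y l
    using assms(2) min[OF that(1)] that unfolding assumption_A2_def strictly_quasi_convex_def by auto
  have le: "h x \<le> h y" if "xs \<le> x \<and> x \<le> y \<or> y \<le> x \<and> x \<le> xs" for x y
  proof -
    consider "x = y" | "x = xs" "y \<noteq> xs" | "x \<noteq> y" "x \<noteq> xs" by blast
    then show ?thesis
    proof cases
      case 3
      then have y: "y \<noteq> xs" using that by auto
      define l where "l = (y - x) / (y - xs)"
      have "0 < l" "l < 1" using that 3 y by (auto simp: l_def divide_simps)
      moreover have "l * (y - xs) = y - x" using y by (simp add: l_def)
      then have "l * xs + (1 - l) * y = x" by (simp add: algebra_simps)
      ultimately show ?thesis using between[OF y, of l] by simp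
    qed (use min in \<open>auto intro: less_imp_le\<close>)
  qed
  show "mono_on {xs..} h" "antimono_on {..xs} h"
    by (auto intro!: monotone_onI le)
qed

section \<open>Extremum seeking over one period and over many\<close>

lemma dither_add_nat: "dither (real k + t) = dither t"
  using sin.plus_of_nat[of "2 * pi * t" k] by (simp add: dither_def algebra_simps)

lemma es_field_le:
  assumes "0 \<le> \<gamma>" "\<And>y. \<bar>g y\<bar> \<le> M"
  shows "\<bar>es_field g \<delta> \<gamma> t x\<bar> \<le> \<gamma> * M"
proof -
  have "\<bar>g (x + \<delta> * dither t)\<bar> * \<bar>dither t\<bar> \<le> M * 1"
    by (intro mult_mono assms) (use assms(2)[of 0] in \<open>auto simp: dither_def\<close>)
  then show ?thesis using assms(1) mult_left_mono[of _ M \<gamma>] by (simp add: es_field_def abs_mult mult.assoc)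
qed

lemma es_solution_speed:
  assumes "solution_on (es_field g \<delta> \<gamma>) {a..b} x" "0 \<le> \<gamma>" "\<And>y. \<bar>g y\<bar> \<le> M"
    and "s \<in> {a..b}" "t \<in> {a..b}"
  shows "\<bar>x t - x s\<bar> \<le> \<gamma> * M * \<bar>t - s\<bar>"
  using field_differentiable_bound[of "{a..b}" x "\<lambda>t. es_field g \<delta> \<gamma> t (x t)" "\<gamma> * M" t s]
    assms es_field_le[OF assms(2,3)] by (auto simp: solution_on_def)

text \<open>Freezing the state at its value \<open>x k\<close> in the argument of \<open>g\<close> gives exactly one step of the average
system. Over one period the state moves by at most \<open>\<gamma> M\<close>, so by Lipschitz continuity freezing costs
at most \<open>\<gamma> L (\<gamma> M)\<close>.\<close>

lemma es_period_map:
  fixes k :: nat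
  assumes sol: "solution_on (es_field g \<delta> \<gamma>) {real k..real k + 1} x"
    and "0 \<le> \<gamma>" "0 \<le> L" and cont: "continuous_on UNIV g"
    and M: "\<And>y. \<bar>g y\<bar> \<le> M" and L: "\<And>y z. \<bar>g y - g z\<bar> \<le> L * \<bar>y - z\<bar>"
  shows "\<bar>x (real k + 1) - x (real k) + \<gamma> / 2 * b1 g \<delta> (x (real k))\<bar> \<le> \<gamma>\<^sup>2 * L * M"
proof -
  define z where "z s = x (real k + s)" for s
  have comp: "x \<circ> (\<lambda>s. real k + s) = z" by (simp add: fun_eq_iff z_def)
  have z: "solution_on (es_field g \<delta> \<gamma>) {0..1} z"
    unfolding solution_on_def
  proof
    fix s :: real assume s: "s \<in> {0..1}"
    have im: "(\<lambda>s. real k + s) ` {0..1} = {real k..real k + 1}" by (simp add: add.commute)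
    have "(x has_real_derivative es_field g \<delta> \<gamma> (real k + s) (z s))
        (at (real k + s) within (\<lambda>s. real k + s) ` {0..1})"
      unfolding im z_def using sol[unfolded solution_on_def, THEN bspec, of "real k + s"] s by simp
    then have "(x \<circ> (\<lambda>s. real k + s) has_real_derivative es_field g \<delta> \<gamma> (real k + s) (z s) * 1)
        (at s within {0..1})"
      by (rule DERIV_image_chain) (auto intro!: derivative_eq_intros)
    then show "(z has_real_derivative es_field g \<delta> \<gamma> s (z s)) (at s within {0..1})"
      unfolding comp by (simp add: es_field_def dither_add_nat)
  qed
  define w where "w s = - \<gamma> * (g (z 0 + \<delta> * dither s) * dither s)" for s
  have I1: "((\<lambda>s. es_field g \<delta> \<gamma> s (z s)) has_integral z 1 - z 0) {0..1}"
    using z unfolding solution_on_def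
    by (intro fundamental_theorem_of_calculus) (auto simp: has_real_derivative_iff_has_vector_derivative)
  have "((\<lambda>s. g (z 0 + \<delta> * dither s) * dither s) has_integral b1 g \<delta> (z 0) / 2) {0..1}"
    unfolding b1_def dither_def using integrable_integral[OF b1_integrable[OF cont]] by simp
  then have I2: "(w has_integral - \<gamma> * (b1 g \<delta> (z 0) / 2)) {0..1}"
    unfolding w_def by (rule has_integral_mult_right)
  have "((\<lambda>s. es_field g \<delta> \<gamma> s (z s) - w s) has_integral (z 1 - z 0) - - \<gamma> * (b1 g \<delta> (z 0) / 2)) {0..1}"
    by (intro has_integral_diff I1 I2)
  moreover have "norm (es_field g \<delta> \<gamma> s (z s) - w s) \<le> \<gamma>\<^sup>2 * L * M" if s: "s \<in> {0..1}" for s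
  proof -
    have M0: "M \<ge> 0" using M[of 0] by linarith
    have "\<bar>g (z s + \<delta> * dither s) - g (z 0 + \<delta> * dither s)\<bar> \<le> L * \<bar>z s - z 0\<bar>"
      using L[of "z s + \<delta> * dither s" "z 0 + \<delta> * dither s"] by simp
    also have "\<bar>z s - z 0\<bar> \<le> \<gamma> * M * \<bar>s - 0\<bar>"
      using s by (intro es_solution_speed[OF z \<open>0 \<le> \<gamma>\<close> M]) auto
    also have "\<dots> \<le> \<gamma> * M * 1" using s M0 \<open>0 \<le> \<gamma>\<close> by (intro mult_left_mono) auto
    finally have "\<bar>g (z s + \<delta> * dither s) - g (z 0 + \<delta> * dither s)\<bar> \<le> L * (\<gamma> * M)"
      using \<open>0 \<le> L\<close> by (simp add: mult_left_mono)
    then have "\<bar>g (z s + \<delta> * dither s) - g (z 0 + \<delta> * dither s)\<bar> * \<bar>dither s\<bar> \<le> L * (\<gamma> * M) * 1"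
      by (intro mult_mono) (use \<open>0 \<le> L\<close> \<open>0 \<le> \<gamma>\<close> M0 in \<open>auto simp: dither_def\<close>)
    then have "\<gamma> * \<bar>(g (z s + \<delta> * dither s) - g (z 0 + \<delta> * dither s)) * dither s\<bar> \<le> \<gamma> * (L * (\<gamma> * M))"
      using \<open>0 \<le> \<gamma>\<close> by (intro mult_left_mono) (auto simp: abs_mult)
    moreover have "es_field g \<delta> \<gamma> s (z s) - w s
        = - (\<gamma> * ((g (z s + \<delta> * dither s) - g (z 0 + \<delta> * dither s)) * dither s))"
      by (simp add: es_field_def w_def algebra_simps)
    ultimately show ?thesis using \<open>0 \<le> \<gamma>\<close> by (simp add: abs_mult power2_eq_square mult_ac)
  qed
  ultimately have "norm ((z 1 - z 0) - - \<gamma> * (b1 g \<delta> (z 0) / 2)) \<le> \<gamma>\<^sup>2 * L * M * measure lborel (cbox 0 (1::real))"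
    using M[of 0] \<open>0 \<le> L\<close> by (intro has_integral_bound) auto
  then show ?thesis by (simp add: z_def)
qed

text \<open>Above the level \<open>v\<close> the sequence decreases by \<open>\<eta>\<close> per step; from below it can overshoot by at most
\<open>\<rho>\<close>. The upper limit \<open>u\<close> records where the descent is known, and the sequence never exceeds it.\<close>

lemma descent_to_threshold:
  fixes y :: "nat \<Rightarrow> real"
  assumes step: "\<And>k. k < n \<Longrightarrow> y (Suc k) \<le> y k + \<rho>"
    and descent: "\<And>k. k < n \<Longrightarrow> v \<le> y k \<Longrightarrow> y k \<le> u \<Longrightarrow> y (Suc k) \<le> y k - \<eta>"
    and "y 0 \<le> u" "v + \<rho> \<le> u" "0 \<le> \<eta>"
  shows "k \<le> n \<Longrightarrow> y k \<le> max (v + \<rho>) (y 0 - real k * \<eta>)"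
proof (induction k)
  case 0
  then show ?case by simp
next
  case (Suc k)
  then have IH: "y k \<le> max (v + \<rho>) (y 0 - real k * \<eta>)" and k: "k < n" by auto
  have "y 0 - real k * \<eta> \<le> u" using assms(3,5) mult_nonneg_nonneg[of "real k" \<eta>] by linarith
  then have u: "y k \<le> u" using IH assms(4) by linarith
  show ?case
  proof (cases "v \<le> y k")
    case True
    then have "y (Suc k) \<le> y k - \<eta>" using descent[OF k _ u] by blast
    also have "\<dots> \<le> max (v + \<rho>) (y 0 - real (Suc k) * \<eta>)"
      using IH assms(5) by (auto simp: algebra_simps max_def split: if_splits)
    finally show ?thesis .
  next
    case False
    then show ?thesis using step[OF k] by linarith
  qed
qed

text \<open>Both sides of the interval \<open>{a..b}\<close> are treated by \<open>descent_to_threshold\<close>, for the samples and for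
their negatives: a drift of size \<open>2 c\<close> moves the average system by \<open>\<gamma> c\<close> per period, and the
averaging error takes away at most half of it. The final \<open>d/8\<close> is the motion since the last sample.\<close>

lemma es_solution_bounds:
  assumes sol: "solution_on (es_field g \<delta> \<gamma>) {0..T} x" and T: "0 \<le> T"
    and g: "continuous_on UNIV g" "\<And>y. \<bar>g y\<bar> \<le> M" "\<And>y z. \<bar>g y - g z\<bar> \<le> L * \<bar>y - z\<bar>"
    and small: "0 \<le> \<gamma>" "0 \<le> L" "0 \<le> c" "\<gamma> * M \<le> d / 8" "\<gamma> * L * M \<le> c / 2"
    and right: "\<And>y. b + d/2 \<le> y \<Longrightarrow> y \<le> hi \<Longrightarrow> 2 * c \<le> b1 g \<delta> y"
    and left: "\<And>y. lo \<le> y \<Longrightarrow> y \<le> a - d/2 \<Longrightarrow> b1 g \<delta> y \<le> - 2 * c"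
    and box: "lo \<le> x 0" "x 0 \<le> hi" "lo \<le> a - 5*d/8" "b + 5*d/8 \<le> hi"
  shows "x T \<le> max (b + 5*d/8) (x 0 - real (nat \<lfloor>T\<rfloor>) * (\<gamma> * c / 2)) + d/8"
    and "min (a - 5*d/8) (x 0 + real (nat \<lfloor>T\<rfloor>) * (\<gamma> * c / 2)) - d/8 \<le> x T"
proof -
  define n where "n = nat \<lfloor>T\<rfloor>"
  define y where "y k = x (real k)" for k :: nat
  have n: "real n \<le> T" "T \<le> real n + 1"
    using T of_int_floor_le[of T] real_of_int_floor_add_one_ge[of T] by (auto simp: n_def)
  have M0: "0 \<le> M" using g(2)[of 0] by linarith
  have speed: "\<bar>x t - x s\<bar> \<le> d/8" if "s \<in> {0..T}" "t \<in> {0..T}" "\<bar>t - s\<bar> \<le> 1" for s t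
  proof -
    have "\<bar>x t - x s\<bar> \<le> \<gamma> * M * \<bar>t - s\<bar>"
      using es_solution_speed[OF sol small(1) g(2)] that by blast
    also have "\<dots> \<le> \<gamma> * M * 1" using that M0 small(1) by (intro mult_left_mono) auto
    finally show ?thesis using small by simp
  qed
  have step: "\<bar>y (Suc k) - y k\<bar> \<le> d/8" if "k < n" for k
    using speed[of "real k" "real (Suc k)"] that n by (auto simp: y_def)
  have last: "\<bar>x T - x (real n)\<bar> \<le> d/8"
    using n by (intro speed) auto
  have map: "\<bar>y (Suc k) - y k + \<gamma> / 2 * b1 g \<delta> (y k)\<bar> \<le> \<gamma> * (c / 2)" if "k < n" for k
  proof -
    have "solution_on (es_field g \<delta> \<gamma>) {real k..real k + 1} x"
      using that n by (intro solution_on_subset[OF sol]) auto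
    then have "\<bar>x (real k + 1) - x (real k) + \<gamma> / 2 * b1 g \<delta> (x (real k))\<bar> \<le> \<gamma>\<^sup>2 * L * M"
      using small g by (intro es_period_map) auto
    also have "\<dots> \<le> \<gamma> * (c / 2)"
      using mult_left_mono[OF small(5) small(1)] by (simp add: power2_eq_square mult_ac)
    finally show ?thesis by (simp add: y_def add.commute)
  qed
  have "y n \<le> max (b + d/2 + d/8) (y 0 - real n * (\<gamma> * c / 2))"
  proof (rule descent_to_threshold[where u = hi and n = n])
    fix k assume k: "k < n"
    show "y (Suc k) \<le> y k + d/8" using step[OF k] by linarith
    assume "b + d/2 \<le> y k" "y k \<le> hi"
    then have "\<gamma> / 2 * (2 * c) \<le> \<gamma> / 2 * b1 g \<delta> (y k)"
      using small by (intro mult_left_mono right) auto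
    then show "y (Suc k) \<le> y k - \<gamma> * c / 2" using abs_le_D1[OF map[OF k]] by simp
  qed (use box(2,4) small(1,3) in \<open>simp_all add: y_def\<close>)
  then show "x T \<le> max (b + 5*d/8) (x 0 - real (nat \<lfloor>T\<rfloor>) * (\<gamma> * c / 2)) + d/8"
    using abs_le_D1[OF last] unfolding n_def[symmetric] y_def by simp
  have "- y n \<le> max (- a + d/2 + d/8) (- y 0 - real n * (\<gamma> * c / 2))"
  proof (rule descent_to_threshold[where u = "- lo" and n = n and y = "\<lambda>k. - y k"])
    fix k assume k: "k < n"
    show "- y (Suc k) \<le> - y k + d/8" using step[OF k] by linarith
    assume "- a + d/2 \<le> - y k" "- y k \<le> - lo"
    then have "\<gamma> / 2 * b1 g \<delta> (y k) \<le> \<gamma> / 2 * (- 2 * c)"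
      using small by (intro mult_left_mono left) auto
    then show "- y (Suc k) \<le> - y k - \<gamma> * c / 2" using abs_le_D2[OF map[OF k]] by simp
  qed (use box(1,3) small(1,3) in \<open>simp_all add: y_def\<close>)
  then show "min (a - 5*d/8) (x 0 + real (nat \<lfloor>T\<rfloor>) * (\<gamma> * c / 2)) - d/8 \<le> x T"
    using abs_le_D2[OF last] unfolding n_def[symmetric] y_def by simp
qed

text \<open>The estimates for globally bounded fields are applied to \<open>h\<close> saturated at radius
\<open>\<rho> + 2 \<delta> + d\<close>, which leaves room for the dither around states in the tube
\<open>\<bar>x - xs\<bar> \<le> \<rho> + \<delta> + d\<close>. They keep trajectories strictly inside this tube, so the saturation is never
felt: solutions of the saturated equation solve the original one, and conversely an arbitrary
trajectory cannot reach the boundary of the tube for a first time.\<close>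

lemma es_practical_convergence:
  assumes pos: "0 < \<gamma>" "\<gamma> \<le> 1" "0 \<le> \<delta>" "0 < d" "0 \<le> \<rho>" "0 < c" "0 \<le> L"
    and ab: "a \<le> b" "xs - \<delta> \<le> a" "b \<le> xs + \<delta>"
    and M: "\<And>y. \<bar>y - xs\<bar> \<le> \<rho> + 2 * \<delta> + d \<Longrightarrow> \<bar>h y\<bar> \<le> M"
    and L: "\<And>y z. \<bar>y - xs\<bar> \<le> \<rho> + 2 * \<delta> + d \<Longrightarrow> \<bar>z - xs\<bar> \<le> \<rho> + 2 * \<delta> + d \<Longrightarrow>
      \<bar>h y - h z\<bar> \<le> L * \<bar>y - z\<bar>"
    and small: "\<gamma> * M \<le> d / 8" "\<gamma> * L * M \<le> c / 2"
    and right: "\<And>y. b + d/2 \<le> y \<Longrightarrow> y \<le> xs + (\<rho> + \<delta> + d) \<Longrightarrow> 2 * c \<le> b1 h \<delta> y"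
    and left: "\<And>y. xs - (\<rho> + \<delta> + d) \<le> y \<Longrightarrow> y \<le> a - d/2 \<Longrightarrow> b1 h \<delta> y \<le> - 2 * c"
    and x0: "\<bar>x0 - xs\<bar> \<le> \<rho>"
  shows "\<exists>x. trajectory (es_field h \<delta> \<gamma>) x \<and> x 0 = x0"
    and "trajectory (es_field h \<delta> \<gamma>) x \<Longrightarrow> x 0 = x0 \<Longrightarrow> 0 \<le> t \<Longrightarrow> \<bar>x t - xs\<bar> < \<rho> + \<delta> + d"
    and "trajectory (es_field h \<delta> \<gamma>) x \<Longrightarrow> x 0 = x0 \<Longrightarrow> (2 * (\<rho> + \<delta>) / c + 1) / \<gamma> \<le> t \<Longrightarrow>
      x t \<in> {a - d..b + d}"
proof -
  define R where "R = \<rho> + \<delta> + d"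
  define g where "g = saturate xs (R + \<delta>) h"
  have R: "0 \<le> R" "R + \<delta> = \<rho> + 2 * \<delta> + d" using pos by (auto simp: R_def)
  have gM: "\<bar>g y\<bar> \<le> M" for y
    unfolding g_def using R pos M by (intro saturate_bounded) auto
  have gL: "\<bar>g y - g z\<bar> \<le> L * \<bar>y - z\<bar>" for y z
    unfolding g_def using R pos L by (intro saturate_lipschitz) auto
  have gcont: "continuous_on UNIV g"
    by (rule lipschitz_imp_continuous[OF pos(7) gL])
  have g_eq: "es_field g \<delta> \<gamma> t y = es_field h \<delta> \<gamma> t y" if "\<bar>y - xs\<bar> \<le> R" for t y
  proof -
    have "\<bar>\<delta> * dither t\<bar> \<le> \<delta>"
      using mult_left_mono[of "\<bar>dither t\<bar>" 1 \<delta>] pos by (simp add: abs_mult dither_def)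
    then have "g (y + \<delta> * dither t) = h (y + \<delta> * dither t)"
      unfolding g_def using that by (intro saturate_eq) linarith
    then show ?thesis by (simp add: es_field_def)
  qed
  have b1_eq: "b1 g \<delta> y = b1 h \<delta> y" if "\<bar>y - xs\<bar> \<le> R" for y
    unfolding g_def using that pos by (intro b1_cong saturate_eq) linarith
  have gsol: "x T \<le> max (b + 5*d/8) (x0 - real (nat \<lfloor>T\<rfloor>) * (\<gamma> * c / 2)) + d/8"
      "min (a - 5*d/8) (x0 + real (nat \<lfloor>T\<rfloor>) * (\<gamma> * c / 2)) - d/8 \<le> x T"
    if "solution_on (es_field g \<delta> \<gamma>) {0..T} x" "0 \<le> T" "x 0 = x0" for x T
  proof -
    have 1: "2 * c \<le> b1 g \<delta> y" if "b + d/2 \<le> y" "y \<le> xs + R" for y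
      using right[of y] that b1_eq[of y] ab pos by (simp add: R_def)
    have 2: "b1 g \<delta> y \<le> - 2 * c" if "xs - R \<le> y" "y \<le> a - d/2" for y
      using left[of y] that b1_eq[of y] ab pos by (simp add: R_def)
    have box: "xs - R \<le> x 0" "x 0 \<le> xs + R" "xs - R \<le> a - 5*d/8" "b + 5*d/8 \<le> xs + R"
      using x0 ab pos that(3) by (auto simp: R_def abs_le_iff)
    have nn: "0 \<le> \<gamma>" "0 \<le> c" using pos by auto
    show "x T \<le> max (b + 5*d/8) (x0 - real (nat \<lfloor>T\<rfloor>) * (\<gamma> * c / 2)) + d/8"
      using es_solution_bounds(1)[OF that(1,2) gcont gM gL nn(1) pos(7) nn(2) small 1 2 box]
      by (simp add: that(3))
    show "min (a - 5*d/8) (x0 + real (nat \<lfloor>T\<rfloor>) * (\<gamma> * c / 2)) - d/8 \<le> x T"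
      using es_solution_bounds(2)[OF that(1,2) gcont gM gL nn(1) pos(7) nn(2) small 1 2 box]
      by (simp add: that(3))
  qed
  have tube: "\<bar>x T - xs\<bar> < R"
    if "solution_on (es_field g \<delta> \<gamma>) {0..T} x" "0 \<le> T" "x 0 = x0" for x T
  proof -
    define D where "D = real (nat \<lfloor>T\<rfloor>) * (\<gamma> * c / 2)"
    have "0 \<le> D" using pos by (simp add: D_def)
    then have "max (b + 5*d/8) (x0 - D) \<le> xs + (\<rho> + \<delta> + 5*d/8)"
        "xs - (\<rho> + \<delta> + 5*d/8) \<le> min (a - 5*d/8) (x0 + D)"
      using abs_le_D1[OF x0] abs_le_D2[OF x0] ab pos(3,4,5)
      by (intro max.boundedI min.boundedI; simp)+
    then show ?thesis
      using gsol[OF that] pos(4) unfolding R_def D_def[symmetric] abs_less_iff by linarith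
  qed
  have g_of_h: "solution_on (es_field g \<delta> \<gamma>) {0..T} x"
    if x: "trajectory (es_field h \<delta> \<gamma>) x" "x 0 = x0" and "0 \<le> T" for x T
  proof -
    have sol: "solution_on (es_field h \<delta> \<gamma>) {0..s} x" for s
      using x(1) unfolding trajectory_iff_solution_on by (rule solution_on_subset) auto
    have "\<bar>x t - xs\<bar> < R" if t: "0 \<le> t" for t
    proof (rule ccontr)
      assume "\<not> \<bar>x t - xs\<bar> < R"
      then have hit: "R \<le> \<bar>x t - xs\<bar>" by simp
      have cont: "continuous_on {0..t} (\<lambda>s. \<bar>x s - xs\<bar>)"
        by (intro continuous_intros solution_on_continuous[OF sol])
      have start: "\<bar>x 0 - xs\<bar> < R" using x(2) x0 pos by (simp add: R_def)
      obtain s where s: "0 < s" "\<bar>x s - xs\<bar> = R" "\<And>u. 0 \<le> u \<Longrightarrow> u < s \<Longrightarrow> \<bar>x u - xs\<bar> < R"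
        using first_hitting_time[OF cont start hit t] by blast
      have "\<bar>x u - xs\<bar> \<le> R" if "u \<in> {0..s}" for u
        using s that by (cases "u = s") (auto intro: less_imp_le)
      then have "solution_on (es_field g \<delta> \<gamma>) {0..s} x"
        by (intro solution_on_cong[OF sol] g_eq[symmetric])
      from tube[OF this] show False using s x(2) by simp
    qed
    then show ?thesis
      by (intro solution_on_cong[OF sol] g_eq[symmetric]) (auto intro: less_imp_le)
  qed
  show "\<bar>x t - xs\<bar> < \<rho> + \<delta> + d"
    if "trajectory (es_field h \<delta> \<gamma>) x" "x 0 = x0" "0 \<le> t"
    using tube[OF g_of_h[OF that] that(3,2)] by (simp add: R_def)
  show "x t \<in> {a - d..b + d}"
    if x: "trajectory (es_field h \<delta> \<gamma>) x" "x 0 = x0" and t: "(2 * (\<rho> + \<delta>) / c + 1) / \<gamma> \<le> t"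
  proof -
    define D where "D = real (nat \<lfloor>t\<rfloor>) * (\<gamma> * c / 2)"
    have "0 \<le> (2 * (\<rho> + \<delta>) / c + 1) / \<gamma>" using pos by simp
    then have t0: "0 \<le> t" using t by linarith
    \<comment> \<open>Since \<open>\<gamma> \<le> 1\<close>, the summand \<open>1\<close> in the settling time pays for rounding \<open>t\<close> down.\<close>
    have "1 \<le> 1 / \<gamma>" using pos by simp
    then have "2 * (\<rho> + \<delta>) / c / \<gamma> + 1 \<le> t" using t by (simp add: add_divide_distrib)
    moreover have "t - 1 \<le> real (nat \<lfloor>t\<rfloor>)" using t0 by linarith
    ultimately have "2 * (\<rho> + \<delta>) / c / \<gamma> \<le> real (nat \<lfloor>t\<rfloor>)" by linarith
    then have "2 * (\<rho> + \<delta>) / c / \<gamma> * (\<gamma> * c / 2) \<le> real (nat \<lfloor>t\<rfloor>) * (\<gamma> * c / 2)"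
      using pos by (intro mult_right_mono) auto
    then have D: "\<rho> + \<delta> \<le> D" using pos by (simp add: D_def)
    have "max (b + 5*d/8) (x0 - D) \<le> b + 5*d/8" "a - 5*d/8 \<le> min (a - 5*d/8) (x0 + D)"
      using abs_le_D1[OF x0] abs_le_D2[OF x0] ab pos(4) D
      by (intro max.boundedI min.boundedI; simp)+
    then show ?thesis
      using gsol[OF g_of_h[OF x t0] t0 x(2)] pos(4) unfolding D_def[symmetric] atLeastAtMost_iff
      by linarith
  qed
  show "\<exists>x. trajectory (es_field h \<delta> \<gamma>) x \<and> x 0 = x0"
  proof -
    have "\<exists>x. trajectory (es_field g \<delta> \<gamma>) x \<and> x 0 = x0"
    proof (rule trajectory_exists)
      show "continuous_on UNIV (\<lambda>(t, x). es_field g \<delta> \<gamma> t x)"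
        unfolding es_field_def dither_def case_prod_beta
        by (intro continuous_intros continuous_on_compose2[OF gcont]) auto
      show "\<bar>es_field g \<delta> \<gamma> t x\<bar> \<le> \<gamma> * M" for t x
        using pos gM by (intro es_field_le) auto
      fix t y z
      have "\<bar>g (y + \<delta> * dither t) - g (z + \<delta> * dither t)\<bar> * \<bar>dither t\<bar> \<le> L * \<bar>y - z\<bar> * 1"
        using gL[of "y + \<delta> * dither t" "z + \<delta> * dither t"] pos
        by (intro mult_mono) (auto simp: dither_def)
      then have "\<gamma> * \<bar>(g (z + \<delta> * dither t) - g (y + \<delta> * dither t)) * dither t\<bar> \<le> \<gamma> * (L * \<bar>y - z\<bar>)"
        using pos by (intro mult_left_mono) (auto simp: abs_mult abs_minus_commute)
      moreover have "es_field g \<delta> \<gamma> t y - es_field g \<delta> \<gamma> t z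
          = \<gamma> * ((g (z + \<delta> * dither t) - g (y + \<delta> * dither t)) * dither t)"
        by (simp add: es_field_def algebra_simps)
      ultimately show "\<bar>es_field g \<delta> \<gamma> t y - es_field g \<delta> \<gamma> t z\<bar> \<le> \<gamma> * L * \<bar>y - z\<bar>"
        using pos by (simp add: abs_mult mult.assoc)
    qed
    then obtain x where x: "trajectory (es_field g \<delta> \<gamma>) x" "x 0 = x0" by blast
    have "solution_on (es_field g \<delta> \<gamma>) {0..T} x" for T
      using x(1) unfolding trajectory_iff_solution_on by (rule solution_on_subset) auto
    then have "\<bar>x t - xs\<bar> < R" if "0 \<le> t" for t using tube x(2) that by blast
    then have "solution_on (es_field h \<delta> \<gamma>) {0..} x"
      using x(1) unfolding trajectory_iff_solution_on
      by (elim solution_on_cong) (auto intro!: g_eq less_imp_le)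
    then show ?thesis using x(2) by (auto simp: trajectory_iff_solution_on)
  qed
qed

section \<open>The attractor and the sign of the drift around it\<close>

lemma infdist_ge:
  assumes "A \<noteq> {}" "\<And>w. w \<in> A \<Longrightarrow> e \<le> dist x w"
  shows "e \<le> infdist x A"
  using assms by (auto simp: infdist_def intro!: cINF_greatest)

lemma infdist_uminus_image: "infdist (- x) (uminus ` A) = infdist x A" for x :: real
  by (simp add: infdist_def image_image dist_minus)

text \<open>Reflection of the line; it reduces gaps with upward drift to gaps with downward drift.\<close>

lemma globally_asymptotically_stable_uminus:
  assumes gas: "globally_asymptotically_stable f A"
  shows "globally_asymptotically_stable (\<lambda>t y. - f t (- y)) (uminus ` A)"
proof -
  have refl: "trajectory f (\<lambda>t. - x t)" if "trajectory (\<lambda>t y. - f t (- y)) x" for x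
    using solution_on_uminus[OF that[unfolded trajectory_iff_solution_on]]
    by (simp add: trajectory_iff_solution_on)
  have dist: "infdist (y::real) (uminus ` A) = infdist (- y) A" for y
    using infdist_uminus_image[of "- y" A] by simp
  show ?thesis
    unfolding globally_asymptotically_stable_def dist
  proof (intro conjI allI impI)
    fix \<epsilon> :: real assume "0 < \<epsilon>"
    then obtain \<eta> where "\<eta> > 0"
      and "\<forall>x. trajectory f x \<longrightarrow> infdist (x 0) A < \<eta> \<longrightarrow> (\<forall>t\<ge>0. infdist (x t) A < \<epsilon>)"
      using gas unfolding globally_asymptotically_stable_def by blast
    then show "\<exists>\<eta>>0. \<forall>x. trajectory (\<lambda>t y. - f t (- y)) x \<longrightarrow> infdist (- x 0) A < \<eta> \<longrightarrow>
        (\<forall>t\<ge>0. infdist (- x t) A < \<epsilon>)"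
      using refl by blast
  next
    fix x assume "trajectory (\<lambda>t y. - f t (- y)) x"
    from refl[OF this] show "((\<lambda>t. infdist (- x t) A) \<longlongrightarrow> 0) at_top"
      using gas unfolding globally_asymptotically_stable_def by blast
  qed
qed

lemma equilibrium_in_attractor:
  assumes gas: "globally_asymptotically_stable (\<lambda>_. f) A" and "closed A" "A \<noteq> {}" and "f z = 0"
  shows "z \<in> A"
proof -
  have "trajectory (\<lambda>_. f) (\<lambda>_. z)" using \<open>f z = 0\<close> by (simp add: trajectory_def)
  then have "((\<lambda>t::real. infdist z A) \<longlongrightarrow> 0) at_top"
    using gas unfolding globally_asymptotically_stable_def by fastforce
  then have "infdist z A = 0" by (simp add: tendsto_const_iff)
  then show ?thesis using in_closed_iff_infdist_zero assms by blast
qed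

text \<open>A trajectory that starts in the gap just below \<open>q\<close> moves down. By stability it cannot reach the
midpoint \<open>m\<close>, whose distance from \<open>A\<close> is at least \<open>(q - p)/2\<close>, so it stays between \<open>m\<close> and a level \<open>z'\<close>
below \<open>q\<close>. There its distance from \<open>A\<close> is bounded away from \<open>0\<close>, against attractivity.\<close>

lemma attractor_gap_not_repelling:
  assumes gas: "globally_asymptotically_stable (\<lambda>_. f) A"
    and "p < q" "q \<in> A" and gap: "\<And>w. w \<in> A \<Longrightarrow> w \<le> p \<or> q \<le> w"
    and neg: "\<And>w. p < w \<Longrightarrow> w < q \<Longrightarrow> f w < 0"
    and ex: "\<And>z. p < z \<Longrightarrow> z < q \<Longrightarrow> \<exists>x. trajectory (\<lambda>_. f) x \<and> x 0 = z"
  shows False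
proof -
  define m where "m = (p + q) / 2"
  have m: "p < m" "m < q" using \<open>p < q\<close> by (auto simp: m_def)
  have ne: "A \<noteq> {}" using \<open>q \<in> A\<close> by auto
  obtain \<eta> where \<eta>: "\<eta> > 0" "\<And>x t. trajectory (\<lambda>_. f) x \<Longrightarrow> infdist (x 0) A < \<eta> \<Longrightarrow> 0 \<le> t \<Longrightarrow>
      infdist (x t) A < (q - p) / 2"
  proof -
    have "0 < (q - p) / 2" using \<open>p < q\<close> by simp
    then have "\<exists>\<eta>>0. \<forall>x. trajectory (\<lambda>_. f) x \<longrightarrow> infdist (x 0) A < \<eta> \<longrightarrow> (\<forall>t\<ge>0. infdist (x t) A < (q - p) / 2)"
      using gas unfolding globally_asymptotically_stable_def by blast
    then show thesis using that by blast
  qed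
  \<comment> \<open>Close enough to \<open>q\<close> for the stability estimate, but still above the midpoint.\<close>
  define z where "z = max ((m + q) / 2) (q - \<eta> / 2)"
  have "m < z" "z < q" using m \<eta>(1) by (auto simp: z_def less_max_iff_disj)
  moreover have "q - z < \<eta>" using \<eta>(1) unfolding z_def by linarith
  ultimately have z: "m < z" "z < q" "q - z < \<eta>" by auto
  define z' where "z' = (z + q) / 2"
  have z': "z < z'" "z' < q" using z by (auto simp: z'_def)
  obtain x where x: "trajectory (\<lambda>_. f) x" "x 0 = z" using ex[of z] z m by auto
  have sol: "solution_on (\<lambda>_. f) {0..s} x" for s
    using x(1) unfolding trajectory_iff_solution_on by (rule solution_on_subset) auto
  have "infdist (x 0) A \<le> dist z q" using infdist_le[OF \<open>q \<in> A\<close>] x(2) by simp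
  then have near: "infdist (x t) A < (q - p) / 2" if "0 \<le> t" for t
    using \<eta>(2)[OF x(1) _ that] z by (simp add: dist_real_def)
  have "(q - p) / 2 \<le> infdist m A"
  proof (rule infdist_ge[OF ne])
    fix w assume "w \<in> A"
    from gap[OF this] show "(q - p) / 2 \<le> dist m w" by (auto simp: m_def dist_real_def field_simps abs_if)
  qed
  then have "x t \<noteq> m" if "0 \<le> t" for t using near[OF that] by auto
  have above: "m < x t" if t: "0 \<le> t" for t
  proof (rule ccontr)
    assume "\<not> m < x t"
    then have "\<exists>s. 0 \<le> s \<and> s \<le> t \<and> x s = m"
      using t z x(2) by (intro IVT2' solution_on_continuous[OF sol]) auto
    then show False using \<open>\<And>t. 0 \<le> t \<Longrightarrow> x t \<noteq> m\<close> by blast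
  qed
  have below: "x t < z'" if t: "0 \<le> t" for t
  proof (rule ccontr)
    assume "\<not> x t < z'"
    then obtain s where s: "0 < s" "x s = z'" "\<And>u. 0 \<le> u \<Longrightarrow> u < s \<Longrightarrow> x u < z'"
      using first_hitting_time[OF solution_on_continuous[OF sol, of t], of z'] x(2) z' t
      by (metis not_less)
    obtain \<xi> where \<xi>: "0 < \<xi>" "\<xi> < s" "x s - x 0 = (s - 0) * f (x \<xi>)"
      using solution_on_mvt[OF sol s(1)] by blast
    have "p < x \<xi>" "x \<xi> < q" using above[of \<xi>] s(3)[of \<xi>] \<xi> m z' by auto
    then have "s * f (x \<xi>) < 0" using neg s(1) by (simp add: mult_pos_neg)
    then show False using \<xi>(3) s(2) x(2) z' by simp
  qed
  define e where "e = min (m - p) (q - z')"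
  have "e > 0" using m z' by (simp add: e_def)
  have far: "e \<le> infdist (x t) A" if t: "0 \<le> t" for t
  proof (rule infdist_ge[OF ne])
    fix w assume "w \<in> A"
    from gap[OF this] show "e \<le> dist (x t) w"
      using above[OF t] below[OF t] unfolding e_def dist_real_def by linarith
  qed
  have "((\<lambda>t. infdist (x t) A) \<longlongrightarrow> 0) at_top"
    using gas x(1) unfolding globally_asymptotically_stable_def by blast
  then have "\<forall>\<^sub>F t in at_top. infdist (x t) A < e" using \<open>e > 0\<close> by (rule order_tendstoD)
  then obtain N where N: "\<And>t. N \<le> t \<Longrightarrow> infdist (x t) A < e"
    unfolding eventually_at_top_linorder by blast
  then show False using far[OF max.cobounded2[of 0 N]] N[OF max.cobounded1[of N 0]] by linarith
qed

lemma sign_constant_on_interval: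
  fixes f :: "real \<Rightarrow> real"
  assumes "continuous_on UNIV f" "\<And>w. w \<in> S \<Longrightarrow> f w \<noteq> 0" "is_interval S" "u \<in> S" "v \<in> S" "0 < f u"
  shows "0 < f v"
proof (rule ccontr)
  assume neg: "\<not> 0 < f v"
  have "connected (f ` S)"
    by (intro connected_continuous_image is_interval_connected assms continuous_on_subset[OF assms(1)]) auto
  then have "0 \<in> f ` S"
    using neg assms by (intro connectedD_interval[of "f ` S" "f v" "f u" 0]) auto
  then show False using assms(2) by auto
qed

text \<open>In a gap of \<open>A\<close> there are no equilibria, so \<open>f\<close> has a constant sign and pushes away from one of the
two end points.\<close>

lemma attractor_is_interval:
  assumes gas: "globally_asymptotically_stable (\<lambda>_. f) A" and cont: "continuous_on UNIV f"
    and "closed A" and "a \<in> A" "b \<in> A" "a \<le> w" "w \<le> b"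
    and ex: "\<And>z. a \<le> z \<Longrightarrow> z \<le> b \<Longrightarrow> \<exists>x. trajectory (\<lambda>_. f) x \<and> x 0 = z"
  shows "w \<in> A"
proof (rule ccontr)
  assume w: "w \<notin> A"
  have cl: "compact (A \<inter> {a..w})" "compact (A \<inter> {w..b})"
    using \<open>closed A\<close> by (auto intro: closed_Int_compact)
  have ne: "A \<inter> {a..w} \<noteq> {}" "A \<inter> {w..b} \<noteq> {}" using assms by auto
  obtain p where p: "p \<in> A \<inter> {a..w}" "\<forall>t\<in>A \<inter> {a..w}. t \<le> p"
    by (rule bexE[OF compact_attains_sup[OF cl(1) ne(1)]])
  obtain q where q: "q \<in> A \<inter> {w..b}" "\<forall>t\<in>A \<inter> {w..b}. q \<le> t"
    by (rule bexE[OF compact_attains_inf[OF cl(2) ne(2)]])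
  have pq: "a \<le> p" "p < w" "w < q" "q \<le> b" "p \<in> A" "q \<in> A"
    using p(1) q(1) w by (auto simp: less_le)
  have gap: "t \<le> p \<or> q \<le> t" if "t \<in> A" for t
    using p(2) q(2) that pq by (cases "t \<le> w") force+
  have nz: "f t \<noteq> 0" if "t \<in> {p<..<q}" for t
    using equilibrium_in_attractor[OF gas \<open>closed A\<close>, of t] gap[of t] that pq by auto
  have ex': "\<exists>x. trajectory (\<lambda>_. f) x \<and> x 0 = z" if "p < z" "z < q" for z
    using ex[of z] that pq by simp
  show False
  proof (cases "f w < 0")
    case True
    have "f t < 0" if "p < t" "t < q" for t
      using sign_constant_on_interval[of "\<lambda>t. - f t" "{p<..<q}" w t] nz True that pq cont
      by (auto intro: continuous_intros)
    then show False using attractor_gap_not_repelling[OF gas _ pq(6) gap _ ex'] pq by force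
  next
    case False
    then have "0 < f w" using nz[of w] pq by auto
    then have pos: "0 < f t" if "p < t" "t < q" for t
      using sign_constant_on_interval[OF cont, of "{p<..<q}" w t] nz that pq by auto
    show False
    proof (rule attractor_gap_not_repelling)
      show "globally_asymptotically_stable (\<lambda>_ y. - f (- y)) (uminus ` A)"
        using globally_asymptotically_stable_uminus[OF gas] .
      show "- q < - p" "- p \<in> uminus ` A" using pq by auto
      show "v \<le> - q \<or> - p \<le> v" if "v \<in> uminus ` A" for v using that gap by force
      show "- f (- v) < 0" if "- q < v" "v < - p" for v using pos[of "- v"] that by simp
      show "\<exists>x. trajectory (\<lambda>_ y. - f (- y)) x \<and> x 0 = v" if v: "- q < v" "v < - p" for v
      proof -
        obtain x where "trajectory (\<lambda>_. f) x" "x 0 = - v" using ex'[of "- v"] v by auto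
        then have "trajectory (\<lambda>_ y. - f (- y)) (\<lambda>t. - x t) \<and> - x 0 = v"
          using solution_on_uminus[of "\<lambda>_. f" "{0..}" x] by (simp add: trajectory_iff_solution_on)
        then show ?thesis by blast
      qed
    qed
  qed
qed

text \<open>Outside \<open>{xs - \<delta>..xs + \<delta>}\<close> the average drift does not point away from \<open>xs\<close>, so this interval is
invariant, and there \<open>b1\<close> only sees \<open>h\<close> on \<open>{xs - 2\<delta>..xs + 2\<delta>}\<close>. Saturation preserves the
monotonicity of \<open>h\<close> on both sides of \<open>xs\<close>, so the same invariance holds for the saturated system.\<close>

lemma average_trajectory_exists:
  assumes "0 \<le> \<gamma>" "0 \<le> \<delta>" "0 \<le> L"
    and M: "\<And>y. \<bar>y - xs\<bar> \<le> 2 * \<delta> \<Longrightarrow> \<bar>h y\<bar> \<le> M"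
    and L: "\<And>y z. \<bar>y - xs\<bar> \<le> 2 * \<delta> \<Longrightarrow> \<bar>z - xs\<bar> \<le> 2 * \<delta> \<Longrightarrow> \<bar>h y - h z\<bar> \<le> L * \<bar>y - z\<bar>"
    and mono: "mono_on {xs..} h" "antimono_on {..xs} h"
    and x0: "\<bar>x0 - xs\<bar> \<le> \<delta>"
  shows "\<exists>x. trajectory (average_field h \<delta> \<gamma>) x \<and> x 0 = x0"
proof -
  define g where "g = saturate xs (2 * \<delta>) h"
  define f where "f y = - (\<gamma> / 2) * b1 g \<delta> y" for y
  have gM: "\<bar>g y\<bar> \<le> M" for y
    unfolding g_def using assms M by (intro saturate_bounded) auto
  have gL: "\<bar>g y - g z\<bar> \<le> L * \<bar>y - z\<bar>" for y z
    unfolding g_def using assms L by (intro saturate_lipschitz) auto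
  have gcont: "continuous_on UNIV g"
    by (rule lipschitz_imp_continuous[OF assms(3) gL])
  have gmono: "mono_on {xs..} g" "antimono_on {..xs} g"
    using \<open>0 \<le> \<delta>\<close> unfolding g_def saturate_def
    by (auto intro!: monotone_onI intro: monotone_onD[OF mono(1)] monotone_onD[OF mono(2)])
  have b1_lip: "\<bar>b1 g \<delta> y - b1 g \<delta> z\<bar> \<le> 2 * L * \<bar>y - z\<bar>" for y z
    by (rule b1_lipschitz[OF gcont gL])
  have f_lip: "\<bar>f y - f z\<bar> \<le> \<gamma> * L * \<bar>y - z\<bar>" for y z
  proof -
    have "f y - f z = \<gamma> / 2 * (b1 g \<delta> z - b1 g \<delta> y)" by (simp add: f_def algebra_simps)
    then have "\<bar>f y - f z\<bar> = \<bar>\<gamma> / 2 * (b1 g \<delta> z - b1 g \<delta> y)\<bar>" by (simp only:)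
    also have "\<dots> = \<gamma> / 2 * \<bar>b1 g \<delta> y - b1 g \<delta> z\<bar>"
      using assms(1) by (simp add: abs_mult abs_minus_commute)
    also have "\<dots> \<le> \<gamma> / 2 * (2 * L * \<bar>y - z\<bar>)"
      using assms(1) b1_lip by (intro mult_left_mono) auto
    finally show ?thesis by simp
  qed
  have f_bound: "\<bar>f y\<bar> \<le> \<gamma> * M" for y
  proof -
    have "norm (integral {0..1} (\<lambda>t. g (y + \<delta> * sin (2 * pi * t)) * sin (2 * pi * t)))
        \<le> integral {0..1::real} (\<lambda>_. M)"
    proof (intro integral_norm_bound_integral b1_integrable[OF gcont])
      fix t :: real
      have "\<bar>g (y + \<delta> * sin (2 * pi * t))\<bar> * \<bar>sin (2 * pi * t)\<bar> \<le> M * 1"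
        using gM[of 0] by (intro mult_mono gM) auto
      then show "norm (g (y + \<delta> * sin (2 * pi * t)) * sin (2 * pi * t)) \<le> M" by (simp add: abs_mult)
    qed auto
    then have "\<bar>b1 g \<delta> y\<bar> / 2 \<le> M" by (simp add: b1_def)
    then have "\<gamma> * (\<bar>b1 g \<delta> y\<bar> / 2) \<le> \<gamma> * M" using assms(1) by (rule mult_left_mono)
    then show ?thesis using assms(1) by (simp add: f_def abs_mult)
  qed
  have "\<exists>x. trajectory (\<lambda>_. f) x \<and> x 0 = x0"
  proof (rule trajectory_exists[where f = "\<lambda>_. f", OF _ f_bound f_lip])
    have "continuous_on UNIV f"
      using assms(1,3) by (intro lipschitz_imp_continuous[of "\<gamma> * L", OF _ f_lip]) simp
    then show "continuous_on UNIV (\<lambda>(t::real, x). f x)"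
      unfolding case_prod_beta
      by (rule continuous_on_compose2[where g = f and f = snd]) (auto intro: continuous_on_snd continuous_on_id)
  qed
  then obtain x where x: "trajectory (\<lambda>_. f) x" "x 0 = x0" by blast
  have sol: "solution_on (\<lambda>_. f) {0..} x" using x(1) by (simp add: trajectory_iff_solution_on)
  have upper: "x t \<le> xs + \<delta>" if "0 \<le> t" for t
  proof (rule solution_stays_below[OF sol _ that])
    show "x 0 \<le> xs + \<delta>" using x(2) x0 by linarith
    show "f y \<le> 0" if "xs + \<delta> < y" for y
      using b1_nonneg_right[OF gcont gmono(1) assms(2), of y] that assms(1) by (simp add: f_def)
  qed
  have lower: "- x t \<le> - (xs - \<delta>)" if "0 \<le> t" for t
  proof (rule solution_stays_below[OF solution_on_uminus[OF sol] _ that])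
    show "- x 0 \<le> - (xs - \<delta>)" using x(2) x0 by linarith
    show "- f (- y) \<le> 0" if "- (xs - \<delta>) < y" for y
      using b1_nonpos_left[OF gcont gmono(2) assms(2), of "- y"] that assms(1)
      by (simp add: f_def mult_nonneg_nonpos)
  qed
  have "f (x t) = average_field h \<delta> \<gamma> t (x t)" if "0 \<le> t" for t
  proof -
    have "\<bar>x t - xs\<bar> \<le> \<delta>" using upper[OF that] lower[OF that] by linarith
    then have "b1 g \<delta> (x t) = b1 h \<delta> (x t)"
      unfolding g_def using assms(2) by (intro b1_cong saturate_eq) linarith
    then show ?thesis by (simp add: f_def average_field_def)
  qed
  then have "solution_on (average_field h \<delta> \<gamma>) {0..} x"
    by (intro solution_on_cong[OF sol]) auto
  then show ?thesis using x(2) by (auto simp: trajectory_iff_solution_on)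
qed

text \<open>The average system with gain \<open>2\<close> is \<open>x' = - b1 h \<delta> x\<close>. Since \<open>b1\<close> has no zeros outside \<open>A\<close>, one value
on each side of \<open>A\<close>, supplied by the monotonicity of \<open>h\<close>, determines its sign there.\<close>

lemma attractor_interval_signs:
  assumes "assumption_A1 h xs" "assumption_A2 h xs" "0 < \<delta>" "attractor h xs \<delta> A"
  obtains a b where "a \<le> b" "A = {a..b}" "xs - \<delta> \<le> a" "b \<le> xs + \<delta>"
    "\<And>x. b < x \<Longrightarrow> 0 < b1 h \<delta> x" "\<And>x. x < a \<Longrightarrow> b1 h \<delta> x < 0"
proof -
  have A: "A \<noteq> {}" "compact A" "A \<subseteq> {xs - \<delta>..xs + \<delta>}"
    and gas2: "globally_asymptotically_stable (average_field h \<delta> 2) A"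
    using assms(4) unfolding attractor_def by auto
  have sm: "smooth h" using assms(1) by (simp add: assumption_A1_def)
  then have hcont: "continuous_on UNIV h" by (rule smooth_imp_continuous)
  note mono = quasi_convex_monotone[OF assms(1,2)]
  define f where "f x = - b1 h \<delta> x" for x
  have avg: "average_field h \<delta> 2 = (\<lambda>_. f)" by (simp add: fun_eq_iff average_field_def f_def)
  have gas: "globally_asymptotically_stable (\<lambda>_. f) A" using gas2 by (simp add: avg)
  have bcont: "continuous_on UNIV (b1 h \<delta>)" by (rule b1_continuous[OF sm])
  then have fcont: "continuous_on UNIV f" unfolding f_def by (intro continuous_intros)
  obtain M L where L: "0 < M" "0 < L" "\<And>x. \<bar>x - xs\<bar> \<le> 2 * \<delta> \<Longrightarrow> \<bar>h x\<bar> \<le> M"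
    "\<And>x y. \<bar>x - xs\<bar> \<le> 2 * \<delta> \<Longrightarrow> \<bar>y - xs\<bar> \<le> 2 * \<delta> \<Longrightarrow> \<bar>h x - h y\<bar> \<le> L * \<bar>x - y\<bar>"
    by (rule smooth_lipschitz_bounded_on_interval[OF sm, of xs "2 * \<delta>"]) blast
  have ex: "\<exists>x. trajectory (\<lambda>_. f) x \<and> x 0 = z" if "\<bar>z - xs\<bar> \<le> \<delta>" for z
    using average_trajectory_exists[of 2 \<delta> L xs h M, OF _ _ _ L(3,4) mono that] assms(3) L(2)
    by (simp add: avg)
  obtain a where a: "a \<in> A" "\<forall>t\<in>A. a \<le> t"
    by (rule bexE[OF compact_attains_inf[OF A(2,1)]])
  obtain b where b: "b \<in> A" "\<forall>t\<in>A. t \<le> b"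
    by (rule bexE[OF compact_attains_sup[OF A(2,1)]])
  have ab: "xs - \<delta> \<le> a" "b \<le> xs + \<delta>" "a \<le> b" using a b A(3) by auto
  have clA: "closed A" using A(2) by (rule compact_imp_closed)
  have ex_ab: "\<exists>x. trajectory (\<lambda>_. f) x \<and> x 0 = z" if "a \<le> z" "z \<le> b" for z
    using that ab by (intro ex) linarith
  have mem: "w \<in> A" if "a \<le> w" "w \<le> b" for w
    by (rule attractor_is_interval[OF gas fcont clA a(1) b(1) that ex_ab])
  have eq: "A = {a..b}"
    by (intro equalityI subsetI) (use a(2) b(2) in simp, use mem in simp)
  have nz: "b1 h \<delta> x \<noteq> 0" if "x \<notin> A" for x
    using equilibrium_in_attractor[OF gas clA A(1), of x] that by (auto simp: f_def)
  show thesis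
  proof (rule that[OF ab(3) eq ab(1,2)])
    fix x assume x: "b < x"
    have "0 \<le> b1 h \<delta> (xs + \<delta> + 1)" using b1_nonneg_right[OF hcont mono(1)] assms(3) by simp
    moreover have "b1 h \<delta> (xs + \<delta> + 1) \<noteq> 0" using nz[of "xs + \<delta> + 1"] ab eq by simp
    ultimately have "0 < b1 h \<delta> (xs + \<delta> + 1)" by simp
    then show "0 < b1 h \<delta> x"
      using sign_constant_on_interval[OF bcont, of "{b<..}" "xs + \<delta> + 1" x] nz x ab eq by simp
  next
    fix x assume x: "x < a"
    have "b1 h \<delta> (xs - \<delta> - 1) \<le> 0" using b1_nonpos_left[OF hcont mono(2)] assms(3) by simp
    moreover have "b1 h \<delta> (xs - \<delta> - 1) \<noteq> 0" using nz[of "xs - \<delta> - 1"] ab eq by simp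
    ultimately have "0 < f (xs - \<delta> - 1)" by (simp add: f_def)
    then have "0 < f x"
      using sign_constant_on_interval[OF fcont, of "{..<a}" "xs - \<delta> - 1" x] nz x ab eq by (simp add: f_def)
    then show "b1 h \<delta> x < 0" by (simp add: f_def)
  qed
qed

section \<open>Uniform choice of the constants\<close>

text \<open>An infimum rather than some chosen positive lower bound, in order to be antimonotone in \<open>S\<close>. With
\<open>\<phi> = b1 h \<delta>\<close> it is the least speed of the average system with gain \<open>1\<close> on \<open>S\<close>.\<close>

definition drift_margin :: "(real \<Rightarrow> real) \<Rightarrow> real set \<Rightarrow> real" where
  "drift_margin \<phi> S = Inf ((\<lambda>x. \<bar>\<phi> x\<bar> / 2) ` S)"

lemma drift_margin_le: "x \<in> S \<Longrightarrow> 2 * drift_margin \<phi> S \<le> \<bar>\<phi> x\<bar>"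
  using cInf_lower[of "\<bar>\<phi> x\<bar> / 2" "(\<lambda>x. \<bar>\<phi> x\<bar> / 2) ` S"]
  by (force simp: drift_margin_def intro: bdd_belowI2[of _ 0])

lemma drift_margin_antimono: "S \<noteq> {} \<Longrightarrow> S \<subseteq> T \<Longrightarrow> drift_margin \<phi> T \<le> drift_margin \<phi> S"
  unfolding drift_margin_def by (rule cInf_superset_mono) (auto intro: bdd_belowI2[of _ 0])

lemma drift_margin_pos:
  assumes "compact S" "S \<noteq> {}" "continuous_on UNIV \<phi>" "\<And>x. x \<in> S \<Longrightarrow> \<phi> x \<noteq> 0"
  shows "0 < drift_margin \<phi> S"
proof -
  have "continuous_on S (\<lambda>x. \<bar>\<phi> x\<bar> / 2)"
    by (intro continuous_intros continuous_on_subset[OF assms(3)]) auto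
  then obtain x where x: "x \<in> S" "\<forall>y\<in>S. \<bar>\<phi> x\<bar> / 2 \<le> \<bar>\<phi> y\<bar> / 2"
    using continuous_attains_inf[OF assms(1,2)] by blast
  then have "\<bar>\<phi> x\<bar> / 2 \<le> drift_margin \<phi> S"
    unfolding drift_margin_def using assms(2) by (intro cINF_greatest) auto
  then show ?thesis using assms(4)[OF x(1)] by simp
qed

lemma chi_inverse:
  assumes "class_Kinf (\<lambda>s. \<beta> s 0)" "0 \<le> y"
  shows "0 \<le> chi \<beta> y" "\<beta> (chi \<beta> y) 0 = y"
proof -
  let ?f = "\<lambda>s. \<beta> s 0"
  have K: "continuous_on {0..} ?f" "strict_mono_on {0..} ?f" "\<beta> 0 0 = 0" "filterlim ?f at_top at_top"
    using assms(1) unfolding class_Kinf_def by auto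
  obtain N where "\<And>s. N \<le> s \<Longrightarrow> y \<le> ?f s"
    using filterlim_at_top[THEN iffD1, OF K(4), rule_format, of y] unfolding eventually_at_top_linorder by blast
  then have N: "y \<le> ?f (max N 0)" by simp
  have "\<exists>s. 0 \<le> s \<and> s \<le> max N 0 \<and> ?f s = y"
    using K(3) assms(2) N by (intro IVT' continuous_on_subset[OF K(1)]) auto
  then have mem: "y \<in> ?f ` {0..}" by auto
  have inj: "inj_on ?f {0..}" using K(2) by (rule strict_mono_on_imp_inj_on)
  show "0 \<le> chi \<beta> y" using the_inv_into_into[OF inj mem, of "{0..}"] by (simp add: chi_def)
  show "\<beta> (chi \<beta> y) 0 = y" using f_the_inv_into_f[OF inj mem] by (simp add: chi_def)
qed

text \<open>From \<open>\<bar>h\<bar> \<le> M\<close> on \<open>{xs - r..xs + r}\<close> it follows that \<open>\<alpha> r \<le> \<bar>h (xs + r) - h xs\<bar> \<le> 2 M\<close>, which bounds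
\<open>r\<close>; then \<open>\<beta> (chi \<beta> s) 0 = s \<le> r\<close> bounds \<open>chi \<beta> s\<close>,
because \<open>\<beta> s 0\<close> tends to infinity with \<open>s\<close>.\<close>

lemma initial_radius_bounded:
  assumes "assumption_A2 h xs" "class_Kinf (\<lambda>s. \<beta> s 0)"
  obtains \<rho> where "0 \<le> \<rho>"
    "\<And>r L s. local_bounds h xs r L M \<Longrightarrow> 0 < r \<Longrightarrow> 0 \<le> s \<Longrightarrow> s \<le> r \<Longrightarrow> chi \<beta> s \<le> \<rho>"
proof -
  obtain \<alpha> where \<alpha>: "class_Kinf \<alpha>" "\<And>x y. (x - xs) * (y - xs) \<ge> 0 \<Longrightarrow> \<alpha> \<bar>y - x\<bar> \<le> \<bar>h y - h x\<bar>"
    using assms(1) unfolding assumption_A2_def by blast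
  have lim: "filterlim \<alpha> at_top at_top" "filterlim (\<lambda>s. \<beta> s 0) at_top at_top"
    using \<alpha>(1) assms(2) unfolding class_Kinf_def by auto
  obtain R where R: "\<And>s. R \<le> s \<Longrightarrow> 2 * M + 1 \<le> \<alpha> s"
    using filterlim_at_top[THEN iffD1, OF lim(1), rule_format, of "2 * M + 1"]
    unfolding eventually_at_top_linorder by blast
  obtain \<rho> where \<rho>: "\<And>s. \<rho> \<le> s \<Longrightarrow> R \<le> \<beta> s 0"
    using filterlim_at_top[THEN iffD1, OF lim(2), rule_format, of R]
    unfolding eventually_at_top_linorder by blast
  show thesis
  proof (rule that[of "max \<rho> 0"])
    fix r L s assume lb: "local_bounds h xs r L M" and r: "0 < r" and s: "0 \<le> s" "s \<le> r"
    have "\<bar>h (xs + r)\<bar> \<le> M" "\<bar>h xs\<bar> \<le> M" using lb r by (auto simp: local_bounds_def)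
    moreover have "\<alpha> r \<le> \<bar>h (xs + r) - h xs\<bar>" using \<alpha>(2)[of xs "xs + r"] r by simp
    ultimately have "\<alpha> r \<le> 2 * M" by linarith
    then have "r < R" using R[of r] by force
    then have "\<beta> (chi \<beta> s) 0 < R" using chi_inverse(2)[of \<beta>, OF assms(2) s(1)] s by simp
    then show "chi \<beta> s \<le> max \<rho> 0" using \<rho>[of "chi \<beta> s"] by force
  qed simp
qed

section \<open>Practical convergence of extremum seeking\<close>

theorem proposition1:
  fixes h :: "real \<Rightarrow> real" and xs \<delta> :: real
    and A :: "real set" and \<beta> :: "real \<Rightarrow> real \<Rightarrow> real"
  assumes "assumption_A1 h xs" and "assumption_A2 h xs"
    and "\<delta> > 0"
    and "attractor h xs \<delta> A" and "KL_estimate h \<delta> A \<beta>"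
  shows "\<exists>(tbar :: real \<Rightarrow> real \<Rightarrow> real) (\<gamma>star :: real \<Rightarrow> real \<Rightarrow> real \<Rightarrow> real \<Rightarrow> real).
    \<forall>r d L M r0. r > 0 \<longrightarrow> d > 0 \<longrightarrow> r - d - 2 * \<delta> > 0 \<longrightarrow> local_bounds h xs r L M \<longrightarrow>
      r0 = chi \<beta> (r - d - 2 * \<delta>) \<longrightarrow>
      tbar r0 d \<ge> 0 \<and> \<gamma>star M L \<delta> d > 0 \<and>
      (\<forall>\<gamma>\<in>{0<..<\<gamma>star M L \<delta> d}. \<forall>x0. \<bar>x0 - xs\<bar> \<le> r0 \<longrightarrow>
        (\<exists>x. trajectory (es_field h \<delta> \<gamma>) x \<and> x 0 = x0) \<and>
        (\<forall>x. trajectory (es_field h \<delta> \<gamma>) x \<longrightarrow> x 0 = x0 \<longrightarrow>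
           bounded (x ` {0..}) \<and> (\<forall>t\<ge>tbar r0 d / \<gamma>. infdist (x t) A \<le> d)))"
proof -
  obtain a b where ab: "a \<le> b" "A = {a..b}" "xs - \<delta> \<le> a" "b \<le> xs + \<delta>"
    and sign: "\<And>x. b < x \<Longrightarrow> 0 < b1 h \<delta> x" "\<And>x. x < a \<Longrightarrow> b1 h \<delta> x < 0"
    by (rule attractor_interval_signs[OF assms(1-4)]) blast
  have sm: "smooth h" using assms(1) by (simp add: assumption_A1_def)
  have Kinf: "class_Kinf (\<lambda>s. \<beta> s 0)" using assms(5) by (simp add: KL_estimate_def)
  \<comment> \<open>The states at distance at least \<open>d/2\<close> from \<open>A\<close> that a trajectory with initial radius \<open>\<rho>\<close>
    can visit.\<close>
  define S where "S \<rho> d = {xs - (\<rho> + \<delta> + d)..a - d/2} \<union> {b + d/2..xs + (\<rho> + \<delta> + d)}" for \<rho> d :: real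
  define c where "c \<rho> d = drift_margin (b1 h \<delta>) (S \<rho> d)" for \<rho> d
  have S_ne: "S \<rho> d \<noteq> {}" if "0 \<le> \<rho>" "0 < d" for \<rho> d
    using that ab assms(3) by (auto simp: S_def)
  have c_pos: "0 < c \<rho> d" if "0 \<le> \<rho>" "0 < d" for \<rho> d
    unfolding c_def
  proof (rule drift_margin_pos[OF _ S_ne[OF that] b1_continuous[OF sm]])
    show "compact (S \<rho> d)" by (auto simp: S_def intro: compact_Un)
    show "b1 h \<delta> x \<noteq> 0" if "x \<in> S \<rho> d" for x
    proof -
      have "b < x \<or> x < a" using that \<open>0 < d\<close> by (auto simp: S_def)
      then show ?thesis using sign by force
    qed
  qed
  have c_antimono: "c \<rho>' d \<le> c \<rho> d" if "0 \<le> \<rho>" "\<rho> \<le> \<rho>'" "0 < d" for \<rho> \<rho>' d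
    unfolding c_def by (rule drift_margin_antimono[OF S_ne]) (use that in \<open>auto simp: S_def\<close>)
  have right: "2 * c \<rho> d \<le> b1 h \<delta> y" if "b + d/2 \<le> y" "y \<le> xs + (\<rho> + \<delta> + d)" "0 < d" for \<rho> d y
    using drift_margin_le[of y "S \<rho> d" "b1 h \<delta>"] sign(1)[of y] that by (simp add: S_def c_def)
  have left: "b1 h \<delta> y \<le> - 2 * c \<rho> d" if "xs - (\<rho> + \<delta> + d) \<le> y" "y \<le> a - d/2" "0 < d" for \<rho> d y
    using drift_margin_le[of y "S \<rho> d" "b1 h \<delta>"] sign(2)[of y] that by (simp add: S_def c_def)
  define tbar where "tbar r0 d = 2 * (r0 + \<delta>) / c r0 d + 1" for r0 d
  define P where "P r0 d \<gamma> \<longleftrightarrow> (\<forall>x0. \<bar>x0 - xs\<bar> \<le> r0 \<longrightarrow>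
        (\<exists>x. trajectory (es_field h \<delta> \<gamma>) x \<and> x 0 = x0) \<and>
        (\<forall>x. trajectory (es_field h \<delta> \<gamma>) x \<longrightarrow> x 0 = x0 \<longrightarrow>
           bounded (x ` {0..}) \<and> (\<forall>t\<ge>tbar r0 d / \<gamma>. infdist (x t) A \<le> d)))" for r0 d \<gamma>
  \<comment> \<open>The gain bound \<open>\<gamma>s\<close> is admissible for all radii \<open>r\<close> compatible with the bound \<open>M\<close> at once.\<close>
  define G where "G M d \<gamma>s \<longleftrightarrow> 0 < \<gamma>s \<and>
      (\<forall>r L \<gamma>. 0 < r \<longrightarrow> 0 < r - d - 2 * \<delta> \<longrightarrow> local_bounds h xs r L M \<longrightarrow> \<gamma> \<in> {0<..<\<gamma>s} \<longrightarrow>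
        P (chi \<beta> (r - d - 2 * \<delta>)) d \<gamma>)" for M d \<gamma>s
  have gain: "\<exists>\<gamma>s. G M d \<gamma>s" if d: "0 < d" for M d
  proof -
    obtain \<rho> where \<rho>: "0 \<le> \<rho>"
      "\<And>r L s. local_bounds h xs r L M \<Longrightarrow> 0 < r \<Longrightarrow> 0 \<le> s \<Longrightarrow> s \<le> r \<Longrightarrow> chi \<beta> s \<le> \<rho>"
      by (rule initial_radius_bounded[where \<beta> = \<beta> and M = M, OF assms(2) Kinf]) blast
    obtain M' L' where b: "0 < M'" "0 < L'" "\<And>x. \<bar>x - xs\<bar> \<le> \<rho> + 2 * \<delta> + d \<Longrightarrow> \<bar>h x\<bar> \<le> M'"
      "\<And>x y. \<bar>x - xs\<bar> \<le> \<rho> + 2 * \<delta> + d \<Longrightarrow> \<bar>y - xs\<bar> \<le> \<rho> + 2 * \<delta> + d \<Longrightarrow> \<bar>h x - h y\<bar> \<le> L' * \<bar>x - y\<bar>"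
      by (rule smooth_lipschitz_bounded_on_interval[OF sm, of xs "\<rho> + 2 * \<delta> + d"]) blast
    \<comment> \<open>The bounds for the largest radius \<open>\<rho>\<close> serve every smaller one, as \<open>c \<rho> d \<le> c r0 d\<close>.\<close>
    define \<gamma>s where "\<gamma>s = min 1 (min (d / 8 / M') (c \<rho> d / 2 / (L' * M')))"
    have "0 < \<gamma>s" using d b(1,2) c_pos[OF \<rho>(1) d] by (simp add: \<gamma>s_def)
    moreover have "P (chi \<beta> (r - d - 2 * \<delta>)) d \<gamma>"
      if r: "r > 0" "r - d - 2 * \<delta> > 0" "local_bounds h xs r L M" and \<gamma>: "\<gamma> \<in> {0<..<\<gamma>s}" for r L \<gamma>
    proof -
      define r0 where "r0 = chi \<beta> (r - d - 2 * \<delta>)"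
      have r0: "0 \<le> r0" "r0 \<le> \<rho>"
        using chi_inverse(1)[of \<beta>, OF Kinf, of "r - d - 2 * \<delta>"] \<rho>(2)[OF r(3,1), of "r - d - 2 * \<delta>"] r(1,2) d assms(3)
        by (auto simp: r0_def)
      have \<gamma>': "0 < \<gamma>" "\<gamma> \<le> 1" "\<gamma> < d / 8 / M'" "\<gamma> < c \<rho> d / 2 / (L' * M')"
        using \<gamma> by (auto simp: \<gamma>s_def)
      have small: "\<gamma> * M' \<le> d / 8" "\<gamma> * L' * M' \<le> c r0 d / 2"
      proof -
        show "\<gamma> * M' \<le> d / 8" using \<gamma>'(3) b(1) by (simp add: field_simps)
        have "\<gamma> * (L' * M') < c \<rho> d / 2" using \<gamma>'(4) b(1,2) by (simp add: pos_less_divide_eq)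
        also have "\<dots> \<le> c r0 d / 2" using c_antimono[OF r0 d] by simp
        finally show "\<gamma> * L' * M' \<le> c r0 d / 2" by (simp add: mult.assoc)
      qed
      have pos: "0 \<le> \<delta>" "0 < c r0 d" "0 \<le> L'" using assms(3) c_pos[OF r0(1) d] b(2) by auto
      have hM: "\<bar>h y\<bar> \<le> M'" if "\<bar>y - xs\<bar> \<le> r0 + 2 * \<delta> + d" for y using b(3) that r0 by simp
      have hL: "\<bar>h y - h z\<bar> \<le> L' * \<bar>y - z\<bar>"
        if "\<bar>y - xs\<bar> \<le> r0 + 2 * \<delta> + d" "\<bar>z - xs\<bar> \<le> r0 + 2 * \<delta> + d" for y z using b(4) that r0 by simp
      show ?thesis
        unfolding P_def r0_def[symmetric]
      proof (intro conjI allI impI)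
        fix x0 assume x0: "\<bar>x0 - xs\<bar> \<le> r0"
        note conv = es_practical_convergence[OF \<gamma>'(1,2) pos(1) d r0(1) pos(2,3) ab(1,3,4) hM hL small
            right[OF _ _ d] left[OF _ _ d] x0]
        show "\<exists>x. trajectory (es_field h \<delta> \<gamma>) x \<and> x 0 = x0" by (rule conv(1); assumption)
        fix x assume x: "trajectory (es_field h \<delta> \<gamma>) x" "x 0 = x0"
        have "\<bar>x t\<bar> \<le> \<bar>xs\<bar> + (r0 + \<delta> + d)" if "0 \<le> t" for t
        proof -
          have "\<bar>x t - xs\<bar> < r0 + \<delta> + d" by (rule conv(2); (assumption | rule x that))
          then show ?thesis by linarith
        qed
        then show "bounded (x ` {0..})" by (intro boundedI) auto
        fix t assume t: "tbar r0 d / \<gamma> \<le> t"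
        have xt: "x t \<in> {a - d..b + d}" 
          by (rule conv(3); (assumption | rule x t[unfolded tbar_def]))
        define w where "w = max a (min b (x t))"
        have "w \<in> A" "dist (x t) w \<le> d" using xt ab(1) d by (auto simp: ab(2) w_def dist_real_def)
        then show "infdist (x t) A \<le> d" by (rule infdist_le2)
      qed
    qed
    ultimately have "G M d \<gamma>s" unfolding G_def by blast
    then show ?thesis by blast
  qed
  define \<Gamma> where "\<Gamma> M d = (SOME \<gamma>s. G M d \<gamma>s)" for M d
  have \<Gamma>: "G M d (\<Gamma> M d)" if "0 < d" for M d
    unfolding \<Gamma>_def by (rule someI_ex[OF gain[OF that]])
  have tbar: "0 \<le> tbar (chi \<beta> (r - d - 2 * \<delta>)) d" if "d > 0" "r - d - 2 * \<delta> > 0" for r d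
  proof -
    have "0 \<le> chi \<beta> (r - d - 2 * \<delta>)" using chi_inverse(1)[of \<beta>, OF Kinf] that by simp
    then show ?thesis using assms(3) c_pos[OF _ that(1)] by (simp add: tbar_def less_imp_le)
  qed
  show ?thesis
  proof (rule exI[of _ tbar], rule exI[of _ "\<lambda>M L \<delta>' d. \<Gamma> M d"], intro allI impI, elim ssubst, intro conjI)
    fix r d L M r0 :: real
    assume *: "0 < r" "0 < d" "0 < r - d - 2 * \<delta>" "local_bounds h xs r L M"
    show "0 \<le> tbar (chi \<beta> (r - d - 2 * \<delta>)) d" using * by (intro tbar)
    have "G M d (\<Gamma> M d)" using *(2) by (rule \<Gamma>)
    then show "0 < \<Gamma> M d" by (simp add: G_def)
    show "\<forall>\<gamma>\<in>{0<..<\<Gamma> M d}. \<forall>x0. \<bar>x0 - xs\<bar> \<le> chi \<beta> (r - d - 2 * \<delta>) \<longrightarrow>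
        (\<exists>x. trajectory (es_field h \<delta> \<gamma>) x \<and> x 0 = x0) \<and>
        (\<forall>x. trajectory (es_field h \<delta> \<gamma>) x \<longrightarrow> x 0 = x0 \<longrightarrow>
           bounded (x ` {0..}) \<and> (\<forall>t\<ge>tbar (chi \<beta> (r - d - 2 * \<delta>)) d / \<gamma>. infdist (x t) A \<le> d))"
    proof
      fix \<gamma> assume "\<gamma> \<in> {0<..<\<Gamma> M d}"
      then have "P (chi \<beta> (r - d - 2 * \<delta>)) d \<gamma>"
        using \<open>G M d (\<Gamma> M d)\<close> * unfolding G_def by blast
      then show "\<forall>x0. \<bar>x0 - xs\<bar> \<le> chi \<beta> (r - d - 2 * \<delta>) \<longrightarrow>
        (\<exists>x. trajectory (es_field h \<delta> \<gamma>) x \<and> x 0 = x0) \<and>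
        (\<forall>x. trajectory (es_field h \<delta> \<gamma>) x \<longrightarrow> x 0 = x0 \<longrightarrow>
           bounded (x ` {0..}) \<and> (\<forall>t\<ge>tbar (chi \<beta> (r - d - 2 * \<delta>)) d / \<gamma>. infdist (x t) A \<le> d))"
        by (simp only: P_def)
    qed
  qed
qed

end
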